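(* Let $n\ge 2$ be an integer and let $\mathcal M=(M_1,\ldots,M_{2n-2})$ be a family of $2n-2$ matchings, each of size $n$, in a bipartite graph. If $\mathcal M$ does not possess a (partial) rainbow matching of size $n$, then $\bigcup_{i=1}^{2n-2} M_i$ is the edge set of a cycle $C$ of length $2n$, and, labelling the edges of $C$ cyclically as $c_1,c_2,\ldots,c_{2n}$, exactly $n-1$ of the $M_i$ are equal to the matching $\{c_2,c_4,\ldots,c_{2n}\}$ of even edges of $C$ and the other $n-1$ of the $M_i$ are equal to the matching $\{c_1,c_3,\ldots,c_{2n-1}\}$ of odd edges of $C$.
   Context: A family $\mathcal M=(M_1,\ldots,M_m)$ of matchings is indexed, so repetitions are allowed. A rainbow matching for $\mathcal M$ is a matching $R$ (a set of pairwise disjoint edges) together with an injective map $\phi:R\to\{1,\ldots,m\}$ such that $e\in M_{\phi(e)}$ for every $e\in R$; equivalently, $R$ is the range of an injective partial choice function from $(M_1,\ldots,M_m)$ and is a matching. Its size is $|R|$. *)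

theory Defs
  imports Main
begin

text \<open>
  Graphs are simple and undirected, with vertex set \<open>V\<close> and edge set \<open>E\<close>; an edge is the set of its
  two end vertices. Graphs are not required to be finite.
\<close>

definition bipartite_graph :: "'a set \<Rightarrow> 'a set set \<Rightarrow> bool" where
  "bipartite_graph V E \<longleftrightarrow>
     (\<exists>A B. A \<union> B = V \<and> A \<inter> B = {} \<and> (\<forall>e\<in>E. \<exists>a\<in>A. \<exists>b\<in>B. e = {a, b}))"

definition matching :: "'a set set \<Rightarrow> 'a set set \<Rightarrow> bool" where
  "matching E M \<longleftrightarrow> M \<subseteq> E \<and> pairwise disjnt M"

text \<open>
  A family is a function \<open>M\<close> on an index set \<open>I\<close>, so different indices may carry the same matching.
\<close>

definition rainbow_matching :: "'a set set \<Rightarrow> 'i set \<Rightarrow> ('i \<Rightarrow> 'a set set) \<Rightarrow> 'a set set \<Rightarrow> bool" where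
  "rainbow_matching E I M R \<longleftrightarrow>
     matching E R \<and> (\<exists>\<phi>. inj_on \<phi> R \<and> \<phi> ` R \<subseteq> I \<and> (\<forall>e\<in>R. e \<in> M (\<phi> e)))"

text \<open>
  \<open>cyclic_labelling k C c\<close>: the edge set \<open>C\<close> is that of a cycle with the \<open>k\<close> distinct vertices
  \<open>v 0, \<dots>, v (k - 1)\<close> in cyclic order, and \<open>c 1, \<dots>, c k\<close> are its edges in that order, the
  last one \<open>c k = {v (k - 1), v 0}\<close> closing the cycle.
\<close>

definition cyclic_labelling :: "nat \<Rightarrow> 'a set set \<Rightarrow> (nat \<Rightarrow> 'a set) \<Rightarrow> bool" where
  "cyclic_labelling k C c \<longleftrightarrow>
     k \<ge> 3 \<and> C = c ` {1..k} \<and>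
     (\<exists>v. inj_on v {..<k} \<and> (\<forall>i\<in>{1..k}. c i = {v (i - 1), v (i mod k)}))"

definition cycle_edge_set :: "nat \<Rightarrow> 'a set set \<Rightarrow> bool" where
  "cycle_edge_set k C \<longleftrightarrow> (\<exists>c. cyclic_labelling k C c)"

definition even_edges :: "nat \<Rightarrow> (nat \<Rightarrow> 'a set) \<Rightarrow> 'a set set" where
  "even_edges k c = c ` {j \<in> {1..k}. even j}"

definition odd_edges :: "nat \<Rightarrow> (nat \<Rightarrow> 'a set) \<Rightarrow> 'a set set" where
  "odd_edges k c = c ` {j \<in> {1..k}. odd j}"

end

theory Submission
  imports Defs
begin

text \<open>
  Let \<open>R\<close> be a rainbow matching of size \<open>k = n - 1\<close>; it leaves \<open>k\<close> colours unused. Contract the edges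
  of \<open>R\<close> to \<open>k\<close> nodes, so that augmentations of \<open>R\<close> become rainbow paths from a source to a sink.
  Every unused colour extends the set of nodes reached so far by at least one node, and since no
  rainbow path reaches the sink, every count in this argument is tight. Hence each unused matching
  is a single path together with edges of \<open>R\<close>, and the paths of different colours agree at every node
  that both of them visit. Exchanging along another path shortens the intersection of \<open>R\<close> with
  a given unused matching, so \<open>R\<close> can be chosen disjoint from one of them, and then it is disjoint
  from all; all unused matchings then equal one Hamiltonian path \<open>P\<close>. Deleting an end edge of \<open>P\<close>
  gives another rainbow matching, in which the unused colours are those of \<open>R\<close>; the same analysis
  for it shows that the remaining \<open>k\<close> matchings are all equal to \<open>R\<close> plus the edge that closes \<open>P\<close> to
  a cycle.
\<close>

subsection \<open>Rainbow matchings as relations\<close>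

definition bimatching :: "('a \<times> 'b) set \<Rightarrow> bool" where
  "bimatching M \<longleftrightarrow> inj_on fst M \<and> inj_on snd M"

lemma bimatching_fstD: "bimatching M \<Longrightarrow> (a, b) \<in> M \<Longrightarrow> (a, b') \<in> M \<Longrightarrow> b = b'"
  unfolding bimatching_def inj_on_def by fastforce

lemma bimatching_sndD: "bimatching M \<Longrightarrow> (a, b) \<in> M \<Longrightarrow> (a', b) \<in> M \<Longrightarrow> a = a'"
  unfolding bimatching_def inj_on_def by fastforce

lemma bimatchingI:
  assumes "\<And>a b b'. (a, b) \<in> M \<Longrightarrow> (a, b') \<in> M \<Longrightarrow> b = b'"
    and "\<And>a a' b. (a, b) \<in> M \<Longrightarrow> (a', b) \<in> M \<Longrightarrow> a = a'"
  shows "bimatching M"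
  using assms unfolding bimatching_def inj_on_def by auto

lemma bimatching_subset: "bimatching M \<Longrightarrow> N \<subseteq> M \<Longrightarrow> bimatching N"
  unfolding bimatching_def by (auto intro: inj_on_subset)

lemma bimatching_converse [simp]: "bimatching (M\<inverse>) \<longleftrightarrow> bimatching M"
  by (auto intro!: bimatchingI dest: bimatching_fstD bimatching_sndD converseI)

lemma bimatching_insert:
  assumes "bimatching M" "a \<notin> Domain M" "b \<notin> Range M"
  shows "bimatching (insert (a, b) M)"
  using assms by (intro bimatchingI) (auto dest: bimatching_fstD bimatching_sndD)

lemma card_Domain_bimatching: "bimatching M \<Longrightarrow> card (Domain M) = card M"
  by (simp add: bimatching_def card_image Domain_fst)

lemma card_Range_bimatching: "bimatching M \<Longrightarrow> card (Range M) = card M"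
  by (simp add: bimatching_def card_image Range_snd)

text \<open>The colouring is an explicit argument because augmentation recolours single edges and
  merges the colourings of two edge sets.\<close>

definition rainbow :: "'i set \<Rightarrow> ('i \<Rightarrow> 'e set) \<Rightarrow> 'e set \<Rightarrow> ('e \<Rightarrow> 'i) \<Rightarrow> bool" where
  "rainbow J M Q \<phi> \<longleftrightarrow> inj_on \<phi> Q \<and> (\<forall>e\<in>Q. \<phi> e \<in> J \<and> e \<in> M (\<phi> e))"

lemma rainbow_empty [simp]: "rainbow J M {} \<phi>"
  by (simp add: rainbow_def)

lemma rainbow_subset: "rainbow J M Q \<phi> \<Longrightarrow> Q' \<subseteq> Q \<Longrightarrow> J \<subseteq> J' \<Longrightarrow> rainbow J' M Q' \<phi>"
  unfolding rainbow_def by (meson inj_on_subset subset_iff)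

lemma rainbow_insert:
  assumes "rainbow J M Q \<phi>" "e \<in> M j" "j \<notin> J"
  shows "rainbow (insert j J) M (insert e Q) (\<phi>(e := j))"
  using assms unfolding rainbow_def inj_on_def by auto

lemma rainbow_converse:
  assumes "rainbow J M Q \<phi>"
  shows "rainbow J (\<lambda>j. (M j)\<inverse>) (Q\<inverse>) (\<lambda>e. \<phi> (prod.swap e))"
proof -
  have "Q\<inverse> = prod.swap ` Q" by force
  then show ?thesis using assms by (auto simp: rainbow_def inj_on_def)
qed

subsection \<open>Rainbow augmentations\<close>

text \<open>
  Contract the edges of \<open>R\<close> to nodes, all other vertices of the first side to one source and all
  other vertices of the second side to one sink; an edge \<open>(a, b)\<close> becomes an arc from the node of
  \<open>a\<close> to the node of \<open>b\<close>. Augmentations of \<open>R\<close> are then paths from the source to the sink. In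
  \<open>grow Z Y J\<close> the nodes \<open>Z\<close> are reached from the source and the nodes \<open>Y\<close> reach the sink, each
  colour of \<open>J\<close> being responsible for exactly one node.
\<close>

locale no_augmentation =
  fixes R :: "('a \<times> 'b) set" and U :: "'i set" and M :: "'i \<Rightarrow> ('a \<times> 'b) set"
  assumes finite_R: "finite R" and bimatching_R: "bimatching R" and finite_U: "finite U"
    and bimatching_M: "j \<in> U \<Longrightarrow> bimatching (M j)"
    and finite_M: "j \<in> U \<Longrightarrow> finite (M j)"
    and card_M: "j \<in> U \<Longrightarrow> card R < card (M j)"
    and maximal: "bimatching Q \<Longrightarrow> finite Q \<Longrightarrow> rainbow U M (Q - R) \<phi> \<Longrightarrow> card Q \<le> card R"
begin

inductive grow :: "('a \<times> 'b) set \<Rightarrow> ('a \<times> 'b) set \<Rightarrow> 'i set \<Rightarrow> bool" where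
  empty: "grow {} {} {}"
| forward: "grow Z Y J \<Longrightarrow> j \<in> U - J \<Longrightarrow> (a, b) \<in> M j \<Longrightarrow> a \<notin> Domain (R - Z) \<Longrightarrow>
    (a', b) \<in> R - Z - Y \<Longrightarrow> grow (insert (a', b) Z) Y (insert j J)"
| backward: "grow Z Y J \<Longrightarrow> j \<in> U - J \<Longrightarrow> (a, b) \<in> M j \<Longrightarrow> b \<notin> Range (R - Y) \<Longrightarrow>
    (a, b') \<in> R - Z - Y \<Longrightarrow> grow Z (insert (a, b') Y) (insert j J)"

section \<open>Grown sets and the exchanges along their paths\<close>

lemma finite_subset_R: "X \<subseteq> R \<Longrightarrow> finite X"
  using finite_R finite_subset by blast

lemma card_Domain_R: "X \<subseteq> R \<Longrightarrow> card (Domain X) = card X"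
  using bimatching_R bimatching_subset card_Domain_bimatching by blast

lemma card_Range_R: "X \<subseteq> R \<Longrightarrow> card (Range X) = card X"
  using bimatching_R bimatching_subset card_Range_bimatching by blast

lemma grow_subset:
  assumes "grow Z Y J"
  shows "Z \<subseteq> R" "Y \<subseteq> R" "Z \<inter> Y = {}" "J \<subseteq> U" "finite J" "card J = card Z + card Y"
proof -
  have "Z \<subseteq> R \<and> Y \<subseteq> R \<and> Z \<inter> Y = {} \<and> J \<subseteq> U \<and> finite J \<and> card J = card Z + card Y"
    using assms
  proof induction
    case empty
    show ?case by simp
  next
    case (forward Z Y J j a b a')
    then have "finite Z" using finite_subset_R by blast
    with forward show ?case by auto
  next
    case (backward Z Y J j a b b')
    then have "finite Y" using finite_subset_R by blast
    with backward show ?case by auto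
  qed
  then show "Z \<subseteq> R" "Y \<subseteq> R" "Z \<inter> Y = {}" "J \<subseteq> U" "finite J" "card J = card Z + card Y"
    by auto
qed

text \<open>Only the new edges need colours from \<open>J\<close>; the edges shared with
  \<open>R\<close> are meant to keep the colours they have in \<open>R\<close>.\<close>

definition exchange :: "'i set \<Rightarrow> ('a \<times> 'b) set \<Rightarrow> bool" where
  "exchange J Q \<longleftrightarrow> bimatching Q \<and> finite Q \<and> card Q = card R \<and> (\<exists>\<phi>. rainbow J M (Q - R) \<phi>)"

lemma exchange_R: "exchange J R"
  by (simp add: exchange_def bimatching_R finite_R)

lemma exchange_mono: "exchange J Q \<Longrightarrow> J \<subseteq> J' \<Longrightarrow> exchange J' Q"
  unfolding exchange_def by (blast intro: rainbow_subset)

lemma exchange_insert: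
  assumes Q: "exchange J Q" and j: "j \<notin> J" "e \<in> M j"
    and q: "f \<in> Q" "e \<notin> Q" "bimatching (insert e (Q - {f}))"
  shows "exchange (insert j J) (insert e (Q - {f}))"
proof -
  from Q obtain \<phi> where \<phi>: "rainbow J M (Q - R) \<phi>" and fin: "finite Q" and c: "card Q = card R"
    unfolding exchange_def by blast
  have "rainbow (insert j J) M (insert e (Q - {f}) - R) (\<phi>(e := j))"
    using rainbow_insert[OF \<phi> j(2,1)] by (rule rainbow_subset) auto
  moreover have "card (insert e (Q - {f})) = card R"
    using q fin c card_Suc_Diff1[of Q f] by simp
  ultimately show ?thesis using fin q unfolding exchange_def by auto
qed

text \<open>One switch of an alternating path: the free vertex moves from \<open>a\<close> to
  \<open>a'\<close>, so switches can be chained.\<close>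

lemma bimatching_forward:
  assumes "bimatching Q" "(a', b) \<in> Q" "a \<notin> Domain Q"
  shows "bimatching (insert (a, b) (Q - {(a', b)}))"
    and "a' \<notin> Domain (insert (a, b) (Q - {(a', b)}))"
    and "Range (insert (a, b) (Q - {(a', b)})) = Range Q"
proof -
  have "b \<notin> Range (Q - {(a', b)})"
    using assms by (auto dest: bimatching_sndD)
  then show "bimatching (insert (a, b) (Q - {(a', b)}))"
    using assms by (intro bimatching_insert) (auto intro: bimatching_subset)
  show "a' \<notin> Domain (insert (a, b) (Q - {(a', b)}))"
    using assms by (auto dest: bimatching_fstD)
  show "Range (insert (a, b) (Q - {(a', b)})) = Range Q"
    using assms by auto
qed

lemma bimatching_backward:
  assumes "bimatching Q" "(a, b') \<in> Q" "b \<notin> Range Q"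
  shows "bimatching (insert (a, b) (Q - {(a, b')}))"
    and "b' \<notin> Range (insert (a, b) (Q - {(a, b')}))"
    and "Domain (insert (a, b) (Q - {(a, b')})) = Domain Q"
proof -
  have "a \<notin> Domain (Q - {(a, b')})"
    using assms by (auto dest: bimatching_fstD)
  then show "bimatching (insert (a, b) (Q - {(a, b')}))"
    using assms by (intro bimatching_insert) (auto intro: bimatching_subset)
  show "b' \<notin> Range (insert (a, b) (Q - {(a, b')}))"
    using assms by (auto dest: bimatching_sndD)
  show "Domain (insert (a, b) (Q - {(a, b')})) = Domain Q"
    using assms by auto
qed

text \<open>The arcs chosen for \<open>Z\<close> form a forest growing out of the source, those for
  \<open>Y\<close> a forest growing into the sink, all in distinct colours. Switching along the path
  to \<open>a\<close> frees \<open>a\<close>, switching along the path from \<open>b\<close> frees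
  \<open>b\<close>, and these paths share no node, so one \<open>Q\<close> frees both. Keeping
  \<open>R - Z - Y\<close> inside \<open>Q\<close> lets the induction continue at a node not reached
  before.\<close>

lemma grow_exchange:
  assumes "grow Z Y J" "a \<notin> Domain (R - Z)" "b \<notin> Range (R - Y)"
  obtains Q where "exchange J Q" "a \<notin> Domain Q" "b \<notin> Range Q" "R - Z - Y \<subseteq> Q"
proof -
  have "\<exists>Q. exchange J Q \<and> a \<notin> Domain Q \<and> b \<notin> Range Q \<and> R - Z - Y \<subseteq> Q"
    using assms
  proof (induction arbitrary: a b)
    case empty
    then show ?case using exchange_R by auto
  next
    case (forward Z Y J j a0 b0 a')
    show ?case
    proof (cases "a = a'")
      case True
      \<comment> \<open>The path ends in the new node: first the tail \<open>a0\<close> of its last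
        arc is freed, then \<open>(a', b0)\<close> is switched to \<open>(a0, b0)\<close>.\<close>
      obtain Q where Q: "exchange J Q" "a0 \<notin> Domain Q" "b \<notin> Range Q" "R - Z - Y \<subseteq> Q"
        using forward.IH[of a0 b] forward.hyps forward.prems by blast
      have mem: "(a', b0) \<in> Q" using Q forward.hyps by blast
      have bQ: "bimatching Q" using Q(1) exchange_def by blast
      note bf = bimatching_forward[OF bQ mem Q(2)]
      have "exchange (insert j J) (insert (a0, b0) (Q - {(a', b0)}))"
        by (rule exchange_insert) (use Q forward.hyps mem bf in auto)
      moreover have "R - insert (a', b0) Z - Y \<subseteq> insert (a0, b0) (Q - {(a', b0)})"
        using Q(4) by auto
      ultimately show ?thesis using bf(2,3) Q(3) True by metis
    next
      case False
      then have "a \<notin> Domain (R - Z)" using forward.prems by auto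
      then obtain Q where "exchange J Q" "a \<notin> Domain Q" "b \<notin> Range Q" "R - Z - Y \<subseteq> Q"
        using forward.IH forward.prems by blast
      then show ?thesis using exchange_mono[of J Q "insert j J"] by blast
    qed
  next
    case (backward Z Y J j a0 b0 b')
    show ?case
    proof (cases "b = b'")
      case True
      obtain Q where Q: "exchange J Q" "a \<notin> Domain Q" "b0 \<notin> Range Q" "R - Z - Y \<subseteq> Q"
        using backward.IH[of a b0] backward.hyps backward.prems by blast
      have mem: "(a0, b') \<in> Q" using Q backward.hyps by blast
      have bQ: "bimatching Q" using Q(1) exchange_def by blast
      note bf = bimatching_backward[OF bQ mem Q(3)]
      have "exchange (insert j J) (insert (a0, b0) (Q - {(a0, b')}))"
        by (rule exchange_insert) (use Q backward.hyps mem bf in auto)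
      moreover have "R - Z - insert (a0, b') Y \<subseteq> insert (a0, b0) (Q - {(a0, b')})"
        using Q(4) by auto
      ultimately show ?thesis using bf(2,3) Q(2) True by metis
    next
      case False
      then have "b \<notin> Range (R - Y)" using backward.prems by auto
      then obtain Q where "exchange J Q" "a \<notin> Domain Q" "b \<notin> Range Q" "R - Z - Y \<subseteq> Q"
        using backward.IH backward.prems by blast
      then show ?thesis using exchange_mono[of J Q "insert j J"] by blast
    qed
  qed
  then show ?thesis using that by blast
qed

text \<open>An arc of a fresh colour from the source side to the sink side would complete an
  augmenting path: once \<open>grow_exchange\<close> has freed both ends, \<open>(a, b)\<close> can
  be added, against \<open>maximal\<close>.\<close>

lemma no_crossing:
  assumes "grow Z Y J" "j \<in> U - J" "(a, b) \<in> M j" "a \<notin> Domain (R - Z)"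
  shows "b \<in> Range (R - Y)"
proof (rule ccontr)
  assume "b \<notin> Range (R - Y)"
  then obtain Q where Q: "exchange J Q" "a \<notin> Domain Q" "b \<notin> Range Q"
    using grow_exchange assms by metis
  then obtain \<phi> where \<phi>: "rainbow J M (Q - R) \<phi>" and *: "bimatching Q" "finite Q" "card Q = card R"
    unfolding exchange_def by blast
  have "rainbow U M (insert (a, b) Q - R) (\<phi>((a, b) := j))"
    using rainbow_insert[OF \<phi> assms(3)] assms(2) grow_subset[OF assms(1)]
    by (auto elim!: rainbow_subset)
  then have "card (insert (a, b) Q) \<le> card R"
    using Q * by (intro maximal bimatching_insert) auto
  moreover have "(a, b) \<notin> Q" using Q by blast
  ultimately show False using * by simp
qed

lemma source_edge_to_R:
  assumes "j \<in> U" "(a, b) \<in> M j" "a \<notin> Domain R"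
  shows "b \<in> Range R"
  using no_crossing[OF grow.empty, of j a b] assms by simp

text \<open>Edges of \<open>M j\<close> have distinct tails, and only \<open>card R - card Z\<close>
  tails are available in nodes outside \<open>Z\<close>.\<close>

lemma card_forward_edges:
  assumes "Z \<subseteq> R" "j \<in> U"
  shows "card Z < card {e \<in> M j. fst e \<notin> Domain (R - Z)}" (is "_ < card ?N")
proof -
  have "fst ` (M j - ?N) \<subseteq> Domain (R - Z)" by auto
  then have "card (fst ` (M j - ?N)) \<le> card (R - Z)"
    using card_mono[of "Domain (R - Z)" "fst ` (M j - ?N)"] finite_R card_Domain_R[of "R - Z"]
    by (simp add: finite_Domain)
  moreover have "card (fst ` (M j - ?N)) = card (M j - ?N)"
    using bimatching_M[OF assms(2)] by (intro card_image) (auto simp: bimatching_def intro: inj_on_subset)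
  moreover have "card (R - Z) = card R - card Z" "card Z \<le> card R"
    using assms finite_R finite_subset_R by (auto simp: card_Diff_subset card_mono)
  moreover have "card (M j) = card ?N + card (M j - ?N)"
    using finite_M[OF assms(2)] card_Un_disjoint[of ?N "M j - ?N"] by (simp add: Un_absorb1)
  ultimately show ?thesis using card_M[OF assms(2)] by linarith
qed

lemma card_snd_image:
  assumes "j \<in> U" "N \<subseteq> M j"
  shows "card (snd ` N) = card N"
  using bimatching_M[OF assms(1)] assms(2) by (intro card_image) (auto simp: bimatching_def intro: inj_on_subset)

text \<open>The more than \<open>card Z\<close> forward arcs have distinct heads, so some head is
  outside \<open>Z\<close>. By \<open>no_crossing\<close> it belongs to a node outside
  \<open>Y\<close>, which is therefore new.\<close>

lemma forward_step:
  assumes "grow Z Y J" "j \<in> U - J"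
  obtains a b a' where "(a, b) \<in> M j" "a \<notin> Domain (R - Z)" "(a', b) \<in> R - Z - Y"
proof -
  let ?N = "{e \<in> M j. fst e \<notin> Domain (R - Z)}"
  note g = grow_subset[OF assms(1)]
  have "\<not> snd ` ?N \<subseteq> Range Z"
  proof
    assume "snd ` ?N \<subseteq> Range Z"
    then have "card (snd ` ?N) \<le> card (Range Z)"
      using g finite_subset_R by (intro card_mono) (auto simp: finite_Range)
    then show False
      using card_forward_edges[of Z j] card_snd_image[of j ?N] card_Range_R[of Z] g assms(2) by auto
  qed
  then obtain a b where ab: "(a, b) \<in> M j" "a \<notin> Domain (R - Z)" "b \<notin> Range Z"
    by (metis (mono_tags, lifting) image_subsetI mem_Collect_eq prod.collapse)
  then obtain a' where "(a', b) \<in> R - Y" using no_crossing assms by blast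
  then show ?thesis using ab that by blast
qed

lemma grow_forward:
  assumes "grow Z Y J" "J \<subseteq> K" "K \<subseteq> U"
  obtains Z' where "grow Z' Y K" "Z \<subseteq> Z'"
proof -
  have "finite (K - J)" using assms finite_U finite_subset by blast
  then have "\<exists>Z'. grow Z' Y K \<and> Z \<subseteq> Z'" using assms
  proof (induction "card (K - J)" arbitrary: Z J)
    case 0
    then have "K = J" by auto
    then show ?case using 0 by blast
  next
    case (Suc m)
    then obtain j where j: "j \<in> K - J" by (metis card.empty ex_in_conv nat.distinct(1))
    then have jU: "j \<in> U - J" using Suc.prems by blast
    obtain a b a' where "(a, b) \<in> M j" "a \<notin> Domain (R - Z)" "(a', b) \<in> R - Z - Y"
      using forward_step Suc.prems jU by metis
    then have "grow (insert (a', b) Z) Y (insert j J)"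
      using grow.forward Suc.prems jU by blast
    moreover have "K - insert j J = (K - J) - {j}" by blast
    then have "m = card (K - insert j J)" "finite (K - insert j J)"
      using Suc.hyps(2) Suc.prems(1) j by auto
    moreover have "insert j J \<subseteq> K" using j Suc.prems by blast
    ultimately obtain Z' where "grow Z' Y K" "insert (a', b) Z \<subseteq> Z'"
      using Suc.hyps(1) Suc.prems by metis
    then show ?case by blast
  qed
  then show ?thesis using that by blast
qed

lemma card_U_le: "card U \<le> card R"
proof -
  obtain Z where "grow Z {} U" using grow_forward[OF grow.empty] by blast
  then show ?thesis using grow_subset[of Z "{}" U] card_mono[OF finite_R, of Z] by simp
qed

section \<open>Reversal of all arcs\<close>

lemma no_augmentation_converse: "no_augmentation (R\<inverse>) U (\<lambda>j. (M j)\<inverse>)"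
proof
  fix Q and \<phi> :: "'b \<times> 'a \<Rightarrow> 'i"
  assume Q: "bimatching Q" "finite Q" "rainbow U (\<lambda>j. (M j)\<inverse>) (Q - R\<inverse>) \<phi>"
  have "(Q - R\<inverse>)\<inverse> = Q\<inverse> - R" by blast
  then have "rainbow U M (Q\<inverse> - R) (\<lambda>e. \<phi> (prod.swap e))"
    using rainbow_converse[OF Q(3)] by simp
  then show "card Q \<le> card (R\<inverse>)"
    using maximal[of "Q\<inverse>"] Q by simp
qed (use finite_R bimatching_R finite_U bimatching_M finite_M card_M in auto)

interpretation conv: no_augmentation "R\<inverse>" U "\<lambda>j. (M j)\<inverse>"
  by (rule no_augmentation_converse)

text \<open>Reversal exchanges source and sink, so the two sets of nodes change roles and forward
  steps become backward steps.\<close>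

lemma grow_converse:
  assumes "grow Z Y J"
  shows "conv.grow (Y\<inverse>) (Z\<inverse>) J"
  using assms
proof induction
  case empty
  show ?case using conv.grow.empty by simp
next
  case (forward Z Y J j a b a')
  have "conv.grow (Y\<inverse>) (insert (b, a') (Z\<inverse>)) (insert j J)"
  proof (rule conv.grow.backward)
    show "(b, a) \<in> (M j)\<inverse>" "a \<notin> Range (R\<inverse> - Z\<inverse>)" "(b, a') \<in> R\<inverse> - Y\<inverse> - Z\<inverse>"
      using forward.hyps by blast+
  qed (use forward in blast)+
  moreover have "insert (b, a') (Z\<inverse>) = (insert (a', b) Z)\<inverse>" by blast
  ultimately show ?case by simp
next
  case (backward Z Y J j a b b')
  have "conv.grow (insert (b', a) (Y\<inverse>)) (Z\<inverse>) (insert j J)"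
  proof (rule conv.grow.forward)
    show "(b, a) \<in> (M j)\<inverse>" "b \<notin> Domain (R\<inverse> - Y\<inverse>)" "(b', a) \<in> R\<inverse> - Y\<inverse> - Z\<inverse>"
      using backward.hyps by blast+
  qed (use backward in blast)+
  moreover have "insert (b', a) (Y\<inverse>) = (insert (a, b') Y)\<inverse>" by blast
  ultimately show ?case by simp
qed

lemma grow_backward:
  assumes "grow Z Y J" "J \<subseteq> K" "K \<subseteq> U"
  obtains Y' where "grow Z Y' K" "Y \<subseteq> Y'"
proof -
  obtain W where W: "conv.grow W (Z\<inverse>) K" "Y\<inverse> \<subseteq> W"
    using conv.grow_forward[OF grow_converse] assms by blast
  have "grow Z (W\<inverse>) K"
    using no_augmentation.grow_converse[OF no_augmentation_converse W(1)] by simp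
  then show ?thesis using that[of "W\<inverse>"] W(2) by (simp add: converse_subset_swap)
qed

end

subsection \<open>As many unused colours as nodes\<close>

locale tight_no_augmentation = no_augmentation +
  assumes card_U: "card U = card R"
begin

lemma card_Diff_U: "i \<in> U \<Longrightarrow> Suc (card (U - {i})) = card R"
  using card_U finite_U by (metis card_Suc_Diff1)

text \<open>The forward edges of \<open>M i\<close> number at least \<open>card Z + 1\<close>, and
  by \<open>no_crossing\<close> their distinct heads lie in \<open>Range (R - Y)\<close>, which has
  exactly \<open>card Z + 1\<close> elements.\<close>

lemma Range_forward_edges:
  assumes g: "grow Z Y (U - {i})" and i: "i \<in> U"
  shows "Range (R - Y) \<subseteq> snd ` {e \<in> M i. fst e \<notin> Domain (R - Z)}" (is "_ \<subseteq> snd ` ?N")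
proof -
  note s = grow_subset[OF g]
  have "snd ` ?N \<subseteq> Range (R - Y)"
  proof
    fix b assume "b \<in> snd ` ?N"
    then obtain a where "(a, b) \<in> M i" "a \<notin> Domain (R - Z)" by force
    then show "b \<in> Range (R - Y)" using no_crossing[OF g, of i a b] i by blast
  qed
  moreover have "card (Range (R - Y)) \<le> card (snd ` ?N)"
  proof -
    have "card Y \<le> card R" "card (R - Y) = card R - card Y"
      using s(2) finite_R finite_subset_R by (auto simp: card_Diff_subset card_mono)
    then have "card (Range (R - Y)) = Suc (card Z)"
      using s(6) card_Diff_U[OF i] by (simp add: card_Range_R)
    moreover have "card (snd ` ?N) = card ?N" by (rule card_snd_image[OF i]) blast
    ultimately show ?thesis
      using card_forward_edges[OF s(1) i] by linarith
  qed
  moreover have "finite (Range (R - Y))" using finite_R by (simp add: finite_Range)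
  ultimately show ?thesis using card_seteq[of "Range (R - Y)" "snd ` ?N"] by simp
qed

lemma grow_all_but:
  obtains Z where "grow Z {} (U - K)"
  using grow_forward[OF grow.empty, of "U - K"] by auto

lemma Range_R_subset: "i \<in> U \<Longrightarrow> Range R \<subseteq> Range (M i)"
proof -
  assume i: "i \<in> U"
  obtain Z where "grow Z {} (U - {i})" by (rule grow_all_but)
  from Range_forward_edges[OF this i] have "Range (R - {}) \<subseteq> snd ` M i"
    by (rule order_trans) (rule image_mono, simp)
  then show ?thesis by (simp add: Range_snd)
qed

text \<open>Backward steps use up all colours except \<open>i\<close> while \<open>Z\<close> stays
  fixed. Then \<open>b\<close> is not on the sink side \<open>W\<close>, and
  \<open>Range_forward_edges\<close> identifies the edge of \<open>M i\<close> into \<open>b\<close>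
  as a forward edge.\<close>

lemma edge_into_grown:
  assumes "grow Z Y J" "i \<in> U - J" "(a, b) \<in> M i" "b \<in> Range Z"
  shows "a \<notin> Domain (R - Z)"
proof -
  obtain W where g: "grow Z W (U - {i})"
    using grow_backward[OF assms(1), of "U - {i}"] assms(2) grow_subset(4)[OF assms(1)] by blast
  have "Z \<subseteq> R - W" using grow_subset[OF g] by blast
  then have "b \<in> Range (R - W)" using assms(4) by blast
  then have "b \<in> snd ` {e \<in> M i. fst e \<notin> Domain (R - Z)}"
    using Range_forward_edges[OF g] assms(2) by blast
  then obtain a' where "(a', b) \<in> M i" "a' \<notin> Domain (R - Z)" by force
  then show ?thesis using assms bimatching_M bimatching_sndD by (metis DiffD1)
qed

text \<open>If \<open>a\<close> is free, colour \<open>i\<close> alone reaches \<open>b\<close>, and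
  \<open>edge_into_grown\<close> then forbids the predecessor \<open>a'\<close>. If both
  predecessors belong to nodes, the three nodes of \<open>?T\<close> cannot be reached without the
  colours \<open>i\<close> and \<open>i'\<close>, but growth with all other colours misses only two
  nodes.\<close>

lemma in_edges_agree:
  assumes i: "i \<in> U" "i' \<in> U" and c: "(c, b) \<in> R"
    and a: "(a, b) \<in> M i" "(a', b) \<in> M i'" "a \<noteq> c" "a' \<noteq> c" and a': "a' \<in> Domain R"
  shows "a = a'"
proof (rule ccontr)
  assume ne: "a \<noteq> a'"
  have ii: "i \<noteq> i'" using ne a i bimatching_M bimatching_sndD by metis
  obtain d' where d': "(a', d') \<in> R" using a' by blast
  have d'b: "d' \<noteq> b" using d' c a(4) bimatching_R bimatching_sndD by metis
  show False
  proof (cases "a \<in> Domain R")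
    case False
    have "grow {(c, b)} {} {i}"
      using grow.forward[OF grow.empty, of i a b c] i c a False by simp
    then have "a' \<notin> Domain (R - {(c, b)})"
      by (rule edge_into_grown) (use i ii a in auto)
    then show False using d' a by blast
  next
    case True
    then obtain d where d: "(a, d) \<in> R" by blast
    have db: "d \<noteq> b" using d c a(3) bimatching_R bimatching_sndD by metis
    have dd: "d \<noteq> d'" using d d' ne bimatching_R bimatching_sndD by metis
    let ?T = "{(a, d), (a', d'), (c, b)}"
    \<comment> \<open>Consider the first node of \<open>?T\<close> reached. From
      \<open>(a, d)\<close> or \<open>(a', d')\<close> one of the two colours leads on to
      \<open>(c, b)\<close>. As soon as \<open>(c, b)\<close> is reached,
      \<open>edge_into_grown\<close> requires a predecessor that has not been reached.\<close>
    have first: False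
      if g: "grow Z {} J" and J: "i \<notin> J" "i' \<notin> J" and Z: "Z \<inter> ?T = {}"
        and ext: "grow (insert f Z) {} (insert j J)" and j: "j \<in> U" "j \<noteq> i" "j \<noteq> i'" and f: "f \<in> ?T"
      for Z J f j
    proof -
      have enter: False
        if "grow (insert (p, q) Z) {} (insert j J)" "(p, b) \<in> M m" "(p', b) \<in> M m'"
          "{m, m'} = {i, i'}" "(p, q) \<in> R" "(p', q') \<in> R" "(p, q) \<in> ?T" "(p', q') \<in> ?T"
          "p \<noteq> p'" "p \<noteq> c" "p' \<noteq> c" for p q p' q' m m'
      proof -
        have m: "m \<in> U - insert j J" "m' \<in> U - insert m (insert j J)"
          using that(4) i ii J j by (auto simp: doubleton_eq_iff)
        have "grow (insert (c, b) (insert (p, q) Z)) {} (insert m (insert j J))"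
        proof (rule grow.forward[OF that(1) m(1) that(2)])
          show "p \<notin> Domain (R - insert (p, q) Z)"
            using that(5) bimatching_R bimatching_fstD by fastforce
          show "(c, b) \<in> R - insert (p, q) Z - {}"
            using c Z that(10) by auto
        qed
        then have "p' \<notin> Domain (R - insert (c, b) (insert (p, q) Z))"
          by (rule edge_into_grown) (use m that(3) in auto)
        then show False using that Z by auto
      qed
      consider "f = (a, d)" | "f = (a', d')" | "f = (c, b)" using f by blast
      then show False
      proof cases
        case 1
        show False
          by (rule enter[of a d i a' i' d']) (use ext 1 a d d' ne in auto)
      next
        case 2
        show False
          by (rule enter[of a' d' i' a i d]) (use ext 2 a d d' ne in auto)
      next
        case 3
        have "a \<notin> Domain (R - insert (c, b) Z)"
          by (rule edge_into_grown[of _ "{}" "insert j J" i]) (use ext 3 i J j a in auto)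
        then show False using d Z db by auto
      qed
    qed
    have "grow Z {} J \<Longrightarrow> i \<notin> J \<Longrightarrow> i' \<notin> J \<Longrightarrow> Z \<inter> ?T = {}" for Z J
    proof (induction Z "{} :: ('a \<times> 'b) set" J rule: grow.induct)
      case (forward Z J j p q p')
      then show ?case using first[OF forward(1), of "(p', q)" j] grow.forward[OF forward(1,3-6)]
        by blast
    qed auto
    moreover obtain Z where Z: "grow Z {} (U - {i, i'})" by (rule grow_all_but)
    ultimately have "Z \<inter> ?T = {}" by blast
    then have "card (Z \<union> ?T) = card Z + card ?T"
      using grow_subset(1)[OF Z] finite_subset_R by (intro card_Un_disjoint) auto
    moreover have "card ?T = 3" using ne a by auto
    moreover have "card (Z \<union> ?T) \<le> card R"
      using grow_subset(1)[OF Z] c d d' finite_R by (intro card_mono) auto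
    moreover have "card Z + card {i, i'} = card U"
      using grow_subset(6)[OF Z] i finite_U card_Diff_subset[of "{i, i'}" U] card_mono[of U "{i, i'}"]
      by simp
    ultimately show False using ii card_U by simp
  qed
qed

text \<open>Growth without colour \<open>i\<close> never enters \<open>L\<close>: by
  \<open>edge_into_grown\<close> the \<open>M i\<close>-predecessor of the new node would lie
  outside \<open>L\<close> or be the node itself. Such growth misses only one node, and a single
  node closed under predecessors would be a loop. In particular, \<open>M i\<close> contains no
  cycle of two or more nodes, so it is a path when it avoids \<open>R\<close>.\<close>

lemma no_closed_subset:
  assumes i: "i \<in> U" and L: "L \<subseteq> R" "M i \<inter> L = {}"
    and closed: "\<And>a b. (a, b) \<in> M i \<Longrightarrow> b \<in> Range L \<Longrightarrow> a \<in> Domain L"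
  shows "L = {}"
proof -
  have disj: "grow Z Y J \<Longrightarrow> i \<notin> J \<Longrightarrow> Z \<inter> L = {}" for Z Y J
  proof (induction rule: grow.induct)
    case (forward Z Y J j a b a')
    have Z: "Z \<inter> L = {}" using forward by blast
    have "(a', b) \<notin> L"
    proof
      assume ab: "(a', b) \<in> L"
      have g: "grow (insert (a', b) Z) Y (insert j J)"
        using grow.forward forward.hyps by blast
      have "b \<in> Range R" using ab L by blast
      then obtain a3 where a3: "(a3, b) \<in> M i" using Range_R_subset[OF i] by blast
      have "a3 \<notin> Domain (R - insert (a', b) Z)"
        by (rule edge_into_grown[OF g _ a3]) (use i forward.prems in auto)
      moreover have "a3 \<in> Domain L" using closed a3 ab by blast
      ultimately have "a3 = a'" using L Z by blast
      then show False using a3 ab L by blast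
    qed
    then show ?case using Z by blast
  qed auto
  obtain Z where g: "grow Z {} (U - {i})" by (rule grow_all_but)
  have Z: "Z \<inter> L = {}" using disj g by blast
  show ?thesis
  proof (rule ccontr)
    assume "L \<noteq> {}"
    then obtain p q where pq: "(p, q) \<in> L" by auto
    have "card (Z \<union> L) = card Z + card L"
      using Z grow_subset(1)[OF g] L finite_subset_R by (intro card_Un_disjoint) auto
    moreover have "card (Z \<union> L) \<le> card R"
      using grow_subset(1)[OF g] L finite_R by (intro card_mono) auto
    ultimately have "card L \<le> Suc 0"
      using grow_subset(6)[OF g] card_Diff_U[OF i] by simp
    then have Lpq: "L = {(p, q)}"
      using pq finite_subset_R[OF L(1)] by (auto simp: card_le_Suc0_iff_eq)
    have "q \<in> Range (M i)" using pq L Range_R_subset[OF i] by blast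
    then obtain a where "(a, q) \<in> M i" by blast
    moreover from this have "a \<in> Domain L" using closed pq by blast
    ultimately show False using Lpq L by auto
  qed
qed

end

context tight_no_augmentation
begin

section \<open>Mirror images, and the removal of loops\<close>

lemma tight_no_augmentation_converse: "tight_no_augmentation (R\<inverse>) U (\<lambda>j. (M j)\<inverse>)"
  using no_augmentation_converse card_U
  by (simp add: tight_no_augmentation_def tight_no_augmentation_axioms_def)

interpretation conv: tight_no_augmentation "R\<inverse>" U "\<lambda>j. (M j)\<inverse>"
  by (rule tight_no_augmentation_converse)

lemma Domain_R_subset: "i \<in> U \<Longrightarrow> Domain R \<subseteq> Domain (M i)"
  using conv.Range_R_subset by simp

lemma out_edges_agree:
  assumes "i \<in> U" "i' \<in> U" "(a, c) \<in> R" "(a, b) \<in> M i" "(a, b') \<in> M i'" "b \<noteq> c" "b' \<noteq> c"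
    and "b' \<in> Range R"
  shows "b = b'"
  using conv.in_edges_agree[of i i' c a b b'] assms by simp

text \<open>\<open>M i\<close> covers \<open>Domain R\<close> and has just one edge more than
  \<open>R\<close>.\<close>

lemma unique_source:
  assumes "i \<in> U" "card (M i) = Suc (card R)"
  obtains s where "s \<notin> Domain R" "Domain (M i) = insert s (Domain R)"
proof -
  have "card (Domain (M i)) = Suc (card (Domain R))"
    using assms card_Domain_bimatching bimatching_M bimatching_R by metis
  moreover have "finite (Domain R)" using finite_R by (simp add: finite_Domain)
  ultimately have "card (Domain (M i) - Domain R) = Suc 0"
    using Domain_R_subset[OF assms(1)] by (simp add: card_Diff_subset)
  then obtain s where "Domain (M i) - Domain R = {s}" by (auto simp: card_Suc_eq)
  then show ?thesis using Domain_R_subset[OF assms(1)] that[of s] by blast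
qed

lemma unique_sink:
  assumes "i \<in> U" "card (M i) = Suc (card R)"
  obtains t where "t \<notin> Range R" "Range (M i) = insert t (Range R)"
  using tight_no_augmentation.unique_source[OF tight_no_augmentation_converse assms(1)] assms(2) by auto

text \<open>
  A node that is a loop of \<open>M i\<close> can be reached by a path avoiding the non-loop edges of \<open>M i\<close>: the
  out-arcs of any node agree, so predecessors of loops are loops.
\<close>

lemma grow_exchange_loop:
  assumes "grow Z Y J" "i \<in> U - J" "a \<notin> Domain R \<or> a \<in> Domain (Z \<inter> M i)"
  obtains Q where "exchange J Q" "a \<notin> Domain Q" "R - Z \<subseteq> Q" "M i \<inter> Q \<subseteq> R"
proof -
  have "\<exists>Q. exchange J Q \<and> a \<notin> Domain Q \<and> R - Z \<subseteq> Q \<and> M i \<inter> Q \<subseteq> R"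
    using assms
  proof (induction arbitrary: a)
    case empty
    then show ?case using exchange_R by auto
  next
    case (forward Z Y J j a0 b0 a')
    show ?case
    proof (cases "a \<notin> Domain R \<or> a \<in> Domain (Z \<inter> M i)")
      case True
      then obtain Q where "exchange J Q" "a \<notin> Domain Q" "R - Z \<subseteq> Q" "M i \<inter> Q \<subseteq> R"
        using forward by blast
      then show ?thesis using exchange_mono[of J Q "insert j J"] by blast
    next
      case False
      then have a: "a = a'" "(a', b0) \<in> M i" using forward.prems by auto
      have i: "i \<in> U" "i \<in> U - J" and j: "j \<in> U" using forward by auto
      have a0a': "a0 \<noteq> a'" using forward.hyps by blast
      have "a0 \<notin> Domain R \<or> a0 \<in> Domain (Z \<inter> M i)"
      proof (cases "a0 \<in> Domain R")
        case True
        then obtain c where c: "(a0, c) \<in> R" by blast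
        then have cZ: "(a0, c) \<in> Z" using forward.hyps by blast
        obtain d where d: "(a0, d) \<in> M i" using c Domain_R_subset[OF i(1)] by blast
        have "b0 \<noteq> c" using c a0a' forward.hyps bimatching_R bimatching_sndD by fastforce
        moreover have "b0 \<noteq> d" using d a a0a' i bimatching_M bimatching_sndD by fastforce
        ultimately have "d = c"
          using out_edges_agree[OF i(1) j c d, of b0] forward.hyps by blast
        then show ?thesis using cZ d by blast
      qed simp
      then obtain Q where Q: "exchange J Q" "a0 \<notin> Domain Q" "R - Z \<subseteq> Q" "M i \<inter> Q \<subseteq> R"
        using forward.IH i by blast
      have mem: "(a', b0) \<in> Q" using Q forward.hyps by blast
      have bQ: "bimatching Q" using Q(1) exchange_def by blast
      note bf = bimatching_forward[OF bQ mem Q(2)]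
      have "exchange (insert j J) (insert (a0, b0) (Q - {(a', b0)}))"
        by (rule exchange_insert) (use Q forward.hyps mem bf in auto)
      \<comment> \<open>The loop \<open>(a', b0)\<close> is already the edge of \<open>M i\<close>
        at \<open>b0\<close>, so the switch brings in no new edge of \<open>M i\<close>.\<close>
      moreover have "(a0, b0) \<notin> M i" using a a0a' i bimatching_M bimatching_sndD by fastforce
      moreover have "R - insert (a', b0) Z \<subseteq> insert (a0, b0) (Q - {(a', b0)})"
        using Q(3) by auto
      ultimately show ?thesis using bf(2) a(1) Q(4) by blast
    qed
  next
    case (backward Z Y J j a0 b0 b')
    then obtain Q where "exchange J Q" "a \<notin> Domain Q" "R - Z \<subseteq> Q" "M i \<inter> Q \<subseteq> R"
      by blast
    then show ?case using exchange_mono[of J Q "insert j J"] by blast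
  qed
  then show ?thesis using that by blast
qed

text \<open>All edges of \<open>M i\<close> into \<open>Range R\<close> are forward edges, so growth
  without \<open>i\<close> must reach the loop \<open>x\<close>. Freeing its tail removes
  \<open>x\<close> from the matching and adds no edge of \<open>M i\<close>.\<close>

lemma exchange_loop:
  assumes i: "i \<in> U" and x: "x \<in> M i \<inter> R"
  obtains Q where "exchange (U - {i}) Q" "M i \<inter> Q \<subset> M i \<inter> R"
proof -
  obtain p q where pq: "x = (p, q)" by (cases x)
  obtain Z where g: "grow Z {} (U - {i})" by (rule grow_all_but)
  have "q \<in> Range (R - {})" using pq x by blast
  then have "q \<in> snd ` {e \<in> M i. fst e \<notin> Domain (R - Z)}"
    using Range_forward_edges[OF g i] by (rule rev_subsetD)
  then obtain a where a: "(a, q) \<in> M i" "a \<notin> Domain (R - Z)"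
    by (metis (no_types, lifting) imageE mem_Collect_eq prod.collapse)
  have "a = p" using pq x bimatching_sndD[OF bimatching_M[OF i] a(1)] by blast
  then have "(p, q) \<in> Z" using pq x a by blast
  then have p: "p \<notin> Domain R \<or> p \<in> Domain (Z \<inter> M i)" using pq x by blast
  have "i \<in> U - (U - {i})" using i by blast
  from g this p obtain Q where Q: "exchange (U - {i}) Q" "p \<notin> Domain Q" "M i \<inter> Q \<subseteq> R"
    by (rule grow_exchange_loop)
  have "M i \<inter> Q \<subset> M i \<inter> R" using Q(2,3) pq x by blast
  with Q(1) show ?thesis by (rule that)
qed

end

subsection \<open>Extremal families\<close>

lemma rainbow_combine:
  assumes "rainbow I M R \<phi>" "rainbow J M (Q - R) \<psi>" "J \<inter> \<phi> ` R = {}"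
  shows "rainbow (\<phi> ` R \<union> J) M Q (\<lambda>e. if e \<in> R then \<phi> e else \<psi> e)"
  unfolding rainbow_def
proof
  have "inj_on (\<lambda>e. if e \<in> R then \<phi> e else \<psi> e) (R \<union> (Q - R))"
  proof (rule inj_on_disjoint_Un)
    show "inj_on \<phi> R" "inj_on \<psi> (Q - R)" using assms(1,2) by (simp_all add: rainbow_def)
    have "\<psi> ` (Q - R) \<subseteq> J" using assms(2) unfolding rainbow_def by blast
    then show "\<phi> ` R \<inter> \<psi> ` (Q - R) = {}" using assms(3) by blast
  qed
  then show "inj_on (\<lambda>e. if e \<in> R then \<phi> e else \<psi> e) Q"
    by (rule inj_on_subset) blast
  show "\<forall>e\<in>Q. (if e \<in> R then \<phi> e else \<psi> e) \<in> \<phi> ` R \<union> J \<and>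
      e \<in> M (if e \<in> R then \<phi> e else \<psi> e)"
    using assms unfolding rainbow_def by auto
qed

lemma bij_betw_fun_upd_insert:
  assumes "bij_betw g A B" "a \<notin> A" "b \<notin> B"
  shows "bij_betw (g(a := b)) (insert a A) (insert b B)"
proof -
  have "bij_betw (g(a := b)) A B"
    using assms(1,2) by (subst bij_betw_cong[of A _ g]) auto
  then show ?thesis
    using assms(2,3) notIn_Un_bij_betw[of a A "g(a := b)" B] by simp
qed

text \<open>Here \<open>k\<close> stands for n - 1.\<close>

locale extremal_family =
  fixes I :: "'i set" and M :: "'i \<Rightarrow> ('a \<times> 'b) set" and k :: nat
  assumes finite_I: "finite I" and card_I: "card I = 2 * k"
    and bimatching_family: "i \<in> I \<Longrightarrow> bimatching (M i)"
    and card_family: "i \<in> I \<Longrightarrow> card (M i) = Suc k"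
    and no_rainbow: "bimatching Q \<Longrightarrow> finite Q \<Longrightarrow> rainbow I M Q \<phi> \<Longrightarrow> card Q \<le> k"
begin

lemma finite_family: "i \<in> I \<Longrightarrow> finite (M i)"
  using card_family card.infinite by fastforce

definition near_rainbow :: "('a \<times> 'b) set \<Rightarrow> ('a \<times> 'b \<Rightarrow> 'i) \<Rightarrow> bool" where
  "near_rainbow R \<phi> \<longleftrightarrow> bimatching R \<and> finite R \<and> card R = k \<and> rainbow I M R \<phi>"

text \<open>Edges of \<open>R\<close> keep their colours and new edges take the others, so an
  augmentation would be a larger rainbow matching. The size of \<open>R\<close> is left open, since
  this is also used to show that size \<open>k\<close> is attained.\<close>

lemma no_augmentation_maximal:
  assumes R: "bimatching R" "finite R" "rainbow I M R \<phi>"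
    and max: "\<And>Q \<psi>. bimatching Q \<Longrightarrow> finite Q \<Longrightarrow> rainbow I M Q \<psi> \<Longrightarrow> card Q \<le> card R"
  shows "no_augmentation R (I - \<phi> ` R) M"
proof
  show "card R < card (M j)" if "j \<in> I - \<phi> ` R" for j
    using no_rainbow[OF R] card_family that by simp
  fix Q \<psi> assume Q: "bimatching Q" "finite Q" "rainbow (I - \<phi> ` R) M (Q - R) \<psi>"
  have "\<phi> ` R \<union> (I - \<phi> ` R) \<subseteq> I" using R(3) unfolding rainbow_def by blast
  moreover have "rainbow (\<phi> ` R \<union> (I - \<phi> ` R)) M Q (\<lambda>e. if e \<in> R then \<phi> e else \<psi> e)"
    by (rule rainbow_combine[OF R(3) Q(3)]) blast
  ultimately have "rainbow I M Q (\<lambda>e. if e \<in> R then \<phi> e else \<psi> e)"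
    using rainbow_subset[OF _ subset_refl] by blast
  then show "card Q \<le> card R" using max Q by blast
qed (simp_all add: R(1,2) finite_I bimatching_family finite_family)

text \<open>A largest rainbow matching \<open>R\<close> leaves \<open>2 * k - card R\<close>
  colours, and \<open>card_U_le\<close> bounds their number by \<open>card R\<close>.\<close>

lemma near_rainbow_exists: obtains R \<phi> where "near_rainbow R \<phi>"
proof -
  let ?P = "\<lambda>(R, \<phi>). bimatching R \<and> finite R \<and> rainbow I M R \<phi>"
  have "?P ({}, undefined)" by (simp add: bimatching_def)
  moreover have "\<forall>x. ?P x \<longrightarrow> card (fst x) < Suc k"
    using no_rainbow by (auto simp: less_Suc_eq_le)
  ultimately obtain x where x: "?P x" and max: "\<forall>y. ?P y \<longrightarrow> card (fst y) \<le> card (fst x)"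
    using ex_has_greatest_nat[of ?P _ "\<lambda>x. card (fst x)" "Suc k"] by blast
  obtain R \<phi> where x_eq: "x = (R, \<phi>)" by (cases x)
  have R: "bimatching R" "finite R" "rainbow I M R \<phi>" using x x_eq by auto
  interpret no_augmentation R "I - \<phi> ` R" M
    by (rule no_augmentation_maximal[OF R]) (use max x_eq in auto)
  have sub: "\<phi> ` R \<subseteq> I" and "card (\<phi> ` R) = card R"
    using R(3) by (auto simp: rainbow_def card_image)
  then have "card (I - \<phi> ` R) = 2 * k - card R"
    using R(2) card_I by (simp add: card_Diff_subset)
  then have "card R = k" using card_U_le no_rainbow[OF R] by simp
  then show ?thesis using that R unfolding near_rainbow_def by blast
qed

lemma near_rainbow_image:
  assumes "near_rainbow R \<phi>"
  shows "\<phi> ` R \<subseteq> I" "card (\<phi> ` R) = k" "card (I - \<phi> ` R) = k"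
proof -
  have R: "finite R" "card R = k" "rainbow I M R \<phi>"
    using assms by (auto simp: near_rainbow_def)
  then show "\<phi> ` R \<subseteq> I" "card (\<phi> ` R) = k"
    by (auto simp: rainbow_def card_image)
  then show "card (I - \<phi> ` R) = k"
    using R card_I by (simp add: card_Diff_subset)
qed

lemma near_rainbow_tight:
  assumes "near_rainbow R \<phi>"
  shows "tight_no_augmentation R (I - \<phi> ` R) M"
proof -
  have R: "bimatching R" "finite R" "card R = k" "rainbow I M R \<phi>"
    using assms by (auto simp: near_rainbow_def)
  have "no_augmentation R (I - \<phi> ` R) M"
    by (rule no_augmentation_maximal[OF R(1,2,4)]) (use no_rainbow R(3) in auto)
  then show ?thesis using near_rainbow_image[OF assms] R(3)
    by (simp add: tight_no_augmentation_def tight_no_augmentation_axioms_def)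
qed

lemma disjoint_near_rainbow_exists:
  assumes "k > 0"
  obtains R \<phi> i where "near_rainbow R \<phi>" "i \<in> I - \<phi> ` R" "M i \<inter> R = {}"
proof -
  let ?P = "\<lambda>(R, \<phi>, i). near_rainbow R \<phi> \<and> i \<in> I - \<phi> ` R"
  let ?m = "\<lambda>(R, \<phi> :: 'a \<times> 'b \<Rightarrow> 'i, i). card (M i \<inter> R)"
  obtain R0 \<phi>0 where R0: "near_rainbow R0 \<phi>0" by (rule near_rainbow_exists)
  have "I - \<phi>0 ` R0 \<noteq> {}" using near_rainbow_image(3)[OF R0] assms by (metis card.empty less_irrefl)
  then obtain i0 where "i0 \<in> I - \<phi>0 ` R0" by blast
  then have "?P (R0, \<phi>0, i0)" using R0 by simp
  then have "\<exists>x. ?P x \<and> (\<forall>y. ?P y \<longrightarrow> ?m x \<le> ?m y)" by (rule ex_has_least_nat)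
  then obtain x where x: "?P x" and least: "\<forall>y. ?P y \<longrightarrow> ?m x \<le> ?m y" by (elim exE conjE)
  obtain R \<phi> i where x_eq: "x = (R, \<phi>, i)" by (cases x)
  have R: "near_rainbow R \<phi>" and i: "i \<in> I - \<phi> ` R" using x x_eq by simp_all
  interpret tight_no_augmentation R "I - \<phi> ` R" M by (rule near_rainbow_tight[OF R])
  have "M i \<inter> R = {}"
  proof (rule ccontr)
    assume "M i \<inter> R \<noteq> {}"
    then obtain e where "e \<in> M i \<inter> R" by blast
    with i obtain Q where Q: "exchange (I - \<phi> ` R - {i}) Q" "M i \<inter> Q \<subset> M i \<inter> R"
      by (rule exchange_loop)
    then obtain \<psi> where \<psi>: "rainbow (I - \<phi> ` R - {i}) M (Q - R) \<psi>"
      unfolding exchange_def by blast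
    have RI: "rainbow I M R \<phi>" using R near_rainbow_def by blast
    define \<chi> where "\<chi> = (\<lambda>e. if e \<in> R then \<phi> e else \<psi> e)"
    have \<chi>: "rainbow (\<phi> ` R \<union> (I - \<phi> ` R - {i})) M Q \<chi>"
      unfolding \<chi>_def by (rule rainbow_combine[OF RI \<psi>]) blast
    moreover have "\<phi> ` R \<union> (I - \<phi> ` R - {i}) = I - {i}"
      using i near_rainbow_image[OF R] by blast
    ultimately have \<chi>': "rainbow (I - {i}) M Q \<chi>" by simp
    have "rainbow I M Q \<chi>" by (rule rainbow_subset[OF \<chi>']) auto
    then have "near_rainbow Q \<chi>"
      using Q(1) R unfolding exchange_def near_rainbow_def by simp
    moreover have "i \<in> I - \<chi> ` Q" using \<chi>' i unfolding rainbow_def by blast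
    ultimately have "?m x \<le> ?m (Q, \<chi>, i)" using spec[OF least, of "(Q, \<chi>, i)"] by simp
    moreover have "card (M i \<inter> Q) < card (M i \<inter> R)"
      using Q(2) finite_R by (simp add: psubset_card_mono)
    ultimately show False using x_eq by simp
  qed
  then show ?thesis using that R i by blast
qed

text \<open>The loops of \<open>M j\<close> are closed under predecessors along \<open>M i\<close>:
  at a predecessor that is not a loop the out-edges of \<open>M i\<close> and \<open>M j\<close>
  would agree, giving \<open>M j\<close> two edges into \<open>b\<close>. Hence
  \<open>no_closed_subset\<close> applies.\<close>

lemma disjoint_near_rainbow:
  assumes R: "near_rainbow R \<phi>" and i: "i \<in> I - \<phi> ` R" "M i \<inter> R = {}" and j: "j \<in> I - \<phi> ` R"
  shows "M j \<inter> R = {}"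
proof -
  interpret tight_no_augmentation R "I - \<phi> ` R" M by (rule near_rainbow_tight[OF R])
  have card: "card (M m) = Suc (card R)" if "m \<in> I - \<phi> ` R" for m
    using that card_family R near_rainbow_def by simp
  have not_R: "(a, b) \<notin> R" if "(a, b) \<in> M i" for a b using that i by blast
  have "R \<inter> M j = {}"
  proof (rule no_closed_subset[OF i(1)])
    fix a b assume ab: "(a, b) \<in> M i" and "b \<in> Range (R \<inter> M j)"
    then obtain c where c: "(c, b) \<in> R" "(c, b) \<in> M j" by blast
    have ca: "a \<noteq> c" using c ab not_R by blast
    show "a \<in> Domain (R \<inter> M j)"
    proof (cases "a \<in> Domain R")
      case True
      then obtain d where d: "(a, d) \<in> R" by blast
      obtain f where f: "(a, f) \<in> M j" using Domain_R_subset[OF j] True by blast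
      show ?thesis
      proof (cases "f = d")
        case True
        then show ?thesis using d f by blast
      next
        case False
        have "b \<noteq> d" using d ab not_R by blast
        moreover have "b \<in> Range R" using c by blast
        ultimately have "f = b" using out_edges_agree[OF j i(1) d f ab False] by blast
        then have "a = c" using f c(2) bimatching_family[of j] j bimatching_sndD by fast
        then show ?thesis using ca by blast
      qed
    next
      case False
      obtain si where si: "si \<notin> Domain R" "Domain (M i) = insert si (Domain R)"
        using unique_source[OF i(1) card[OF i(1)]] by blast
      obtain sj where sj: "sj \<notin> Domain R" "Domain (M j) = insert sj (Domain R)"
        using unique_source[OF j card[OF j]] by blast
      \<comment> \<open>Here \<open>b\<close> is the first node of \<open>M i\<close>. The source
        edge of \<open>M j\<close> enters a node whose predecessor in \<open>M i\<close> must also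
        be free, hence the same node \<open>b\<close>, where \<open>M j\<close> has a loop.\<close>
      then obtain b2 where b2: "(sj, b2) \<in> M j" by blast
      then have b2R: "b2 \<in> Range R" using source_edge_to_R[OF j] sj(1) by blast
      then obtain c2 where c2: "(c2, b2) \<in> R" by blast
      obtain a3 where a3: "(a3, b2) \<in> M i" using b2R Range_R_subset[OF i(1)] by blast
      have "a3 \<noteq> c2" using a3 not_R c2 by blast
      moreover have "sj \<noteq> c2" using c2 sj by blast
      ultimately have "a3 \<notin> Domain R"
        using in_edges_agree[OF j i(1) c2 b2 a3] sj by blast
      then have "a3 = a" using a3 ab si(2) False by (metis DomainI insertE)
      then have "b2 = b" using a3 ab bimatching_family[of i] i bimatching_fstD by fast
      then have "sj = c" using b2 c(2) bimatching_family[of j] j bimatching_sndD by fast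
      then show ?thesis using c sj by blast
    qed
  qed (use i in auto)
  then show ?thesis by blast
qed

lemma extremal_family_converse: "extremal_family I (\<lambda>i. (M i)\<inverse>) k"
proof
  fix Q and \<phi> :: "'b \<times> 'a \<Rightarrow> 'i"
  assume Q: "bimatching Q" "finite Q" "rainbow I (\<lambda>i. (M i)\<inverse>) Q \<phi>"
  have "rainbow I M (Q\<inverse>) (\<lambda>e. \<phi> (prod.swap e))" using rainbow_converse[OF Q(3)] by simp
  then show "card Q \<le> k" using no_rainbow[of "Q\<inverse>"] Q by simp
qed (use finite_I card_I bimatching_family card_family in auto)

end

locale disjoint_extremal_family = extremal_family I M k
  for I :: "'i set" and M :: "'i \<Rightarrow> ('a \<times> 'b) set" and k +
  fixes R :: "('a \<times> 'b) set" and \<phi> :: "'a \<times> 'b \<Rightarrow> 'i"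
  assumes R: "near_rainbow R \<phi>" and disjoint: "j \<in> I - \<phi> ` R \<Longrightarrow> M j \<inter> R = {}"
begin

abbreviation U where "U \<equiv> I - \<phi> ` R"

interpretation T: tight_no_augmentation R U M
  by (rule near_rainbow_tight[OF R])

lemma card_M_R: "i \<in> U \<Longrightarrow> card (M i) = Suc (card R)"
  using card_family R near_rainbow_def by simp

lemma not_in_R: "j \<in> U \<Longrightarrow> (a, b) \<in> M j \<Longrightarrow> (a, b) \<notin> R"
  using disjoint by blast

text \<open>Neither matching has a loop, so \<open>out_edges_agree\<close> applies at
  \<open>a\<close>.\<close>

lemma inner_edges_agree:
  assumes "j \<in> U" "j' \<in> U" "(a, b) \<in> M j" "a \<in> Domain R" "b \<in> Range R"
  shows "(a, b) \<in> M j'"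
proof -
  obtain c where c: "(a, c) \<in> R" using assms by blast
  obtain b' where b': "(a, b') \<in> M j'" using T.Domain_R_subset assms by blast
  have "b' \<noteq> c" "b \<noteq> c" using c b' assms not_in_R by blast+
  then have "b' = b" using T.out_edges_agree[OF assms(2,1) c b' assms(3)] assms(5) by blast
  then show ?thesis using b' by blast
qed

lemma shifted_near_rainbow:
  assumes j: "j \<in> U" and s: "(s, b) \<in> M j" "s \<notin> Domain R"
  obtains \<psi> where "near_rainbow (M j - {(s, b)}) \<psi>" "I - \<psi> ` (M j - {(s, b)}) = \<phi> ` R"
proof -
  let ?R = "M j - {(s, b)}"
  have jI: "j \<in> I" using j by blast
  obtain t where t: "t \<notin> Range R" "Range (M j) = insert t (Range R)"
    using T.unique_sink[OF j card_M_R[OF j]] by blast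
  then obtain a0 where a0: "(a0, t) \<in> M j" by blast
  obtain s' where s': "s' \<notin> Domain R" "Domain (M j) = insert s' (Domain R)"
    using T.unique_source[OF j card_M_R[OF j]] by blast
  have ss: "s' = s" using s s' by (metis DomainI insertE)
  have bR: "b \<in> Range R" using T.source_edge_to_R[OF j s] .
  then have et: "(a0, t) \<in> ?R" using t a0 by auto
  have fin: "finite ?R" and c: "card ?R = k"
    using finite_family[OF jI] card_family[OF jI] s by auto
  have "card (?R - {(a0, t)}) = card (U - {j})"
    using et fin c near_rainbow_image(3)[OF R] j finite_I by simp
  then obtain g where g: "bij_betw g (?R - {(a0, t)}) (U - {j})"
    using finite_same_card_bij[of "?R - {(a0, t)}" "U - {j}"] fin finite_I by auto
  define \<psi> where "\<psi> = g((a0, t) := j)"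
  have "bij_betw \<psi> (insert (a0, t) (?R - {(a0, t)})) (insert j (U - {j}))"
    unfolding \<psi>_def by (rule bij_betw_fun_upd_insert[OF g]) simp_all
  then have \<psi>: "bij_betw \<psi> ?R U" using et j by (simp add: insert_absorb)
  have mem: "e \<in> M (\<psi> e)" if e: "e \<in> ?R" for e
  proof (cases "e = (a0, t)")
    case True
    then show ?thesis using a0 by (simp add: \<psi>_def)
  next
    case False
    obtain x y where xy: "e = (x, y)" by (cases e)
    have xyj: "(x, y) \<in> M j" using e xy by blast
    have "x \<noteq> s" using xyj s e xy bimatching_fstD[OF bimatching_family[OF jI]] by blast
    then have "x \<in> Domain R" using xyj s' ss by (metis DomainI insertE)
    moreover have "y \<noteq> t" using xyj a0 False xy bimatching_sndD[OF bimatching_family[OF jI]] by blast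
    then have "y \<in> Range R" using xyj t by (metis RangeI insertE)
    moreover have "\<psi> e \<in> U" using \<psi> e bij_betwE by blast
    ultimately show ?thesis using inner_edges_agree[OF j _ xyj] xy by blast
  qed
  have im: "\<psi> ` ?R = U" using \<psi> by (simp add: bij_betw_def)
  have "inj_on \<psi> ?R" using \<psi> by (simp add: bij_betw_def)
  moreover have "\<psi> e \<in> I" if "e \<in> ?R" for e using im that by blast
  ultimately have "rainbow I M ?R \<psi>" using mem unfolding rainbow_def by blast
  then have "near_rainbow ?R \<psi>"
    using fin c bimatching_subset[OF bimatching_family[OF jI]] by (simp add: near_rainbow_def Diff_subset)
  moreover have "I - \<psi> ` ?R = \<phi> ` R" using im near_rainbow_image(1)[OF R] by blast
  ultimately show ?thesis by (rule that)
qed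

lemma forward_closed:
  assumes j: "j \<in> U" and h: "h \<in> \<phi> ` R"
    and ab: "(a, b) \<in> R" "(a, b) \<in> M h" "(a, b') \<in> M j" "(a', b') \<in> R"
  shows "(a', b') \<in> M h"
proof -
  have jI: "j \<in> I" and hI: "h \<in> I" using j h near_rainbow_image(1)[OF R] by blast+
  obtain s where s: "s \<notin> Domain R" "Domain (M j) = insert s (Domain R)"
    using T.unique_source[OF j card_M_R[OF j]] by blast
  then obtain b0 where b0: "(s, b0) \<in> M j" by blast
  let ?R = "M j - {(s, b0)}"
  obtain \<psi> where \<psi>: "near_rainbow ?R \<psi>" "I - \<psi> ` ?R = \<phi> ` R"
    using shifted_near_rainbow[OF j b0 s(1)] by blast
  interpret S: tight_no_augmentation ?R "\<phi> ` R" M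
    using near_rainbow_tight[OF \<psi>(1)] \<psi>(2) by simp
  have c: "(a, b') \<in> ?R" using ab s by blast
  have h': "\<phi> (a', b') \<in> \<phi> ` R" "(a', b') \<in> M (\<phi> (a', b'))"
    using ab(4) R unfolding near_rainbow_def rainbow_def by blast+
  obtain a1 where a1: "(a1, b') \<in> M h" using S.Range_R_subset[OF h] c by blast
  have "a1 \<noteq> a"
  proof
    assume "a1 = a"
    then have "b' = b" using a1 ab(2) bimatching_fstD[OF bimatching_family[OF hI]] by blast
    then show False using ab(1,3) not_in_R[OF j] by blast
  qed
  moreover have "a' \<noteq> a" using ab(3,4) not_in_R[OF j] by blast
  moreover have "a' \<in> Domain ?R" using ab(4) s by blast
  ultimately have "a1 = a'" using S.in_edges_agree[OF h h'(1) c a1 h'(2)] by blast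
  then show ?thesis using a1 by blast
qed

lemma sink_covered:
  assumes j: "j \<in> U" and h: "h \<in> \<phi> ` R" and t: "t \<in> Range (M j)" "t \<notin> Range R"
  shows "t \<in> Range (M h)"
proof -
  obtain s where s: "s \<notin> Domain R" "Domain (M j) = insert s (Domain R)"
    using T.unique_source[OF j card_M_R[OF j]] by blast
  then obtain b0 where b0: "(s, b0) \<in> M j" by blast
  let ?R = "M j - {(s, b0)}"
  obtain \<psi> where \<psi>: "near_rainbow ?R \<psi>" "I - \<psi> ` ?R = \<phi> ` R"
    using shifted_near_rainbow[OF j b0 s(1)] by blast
  interpret S: tight_no_augmentation ?R "\<phi> ` R" M
    using near_rainbow_tight[OF \<psi>(1)] \<psi>(2) by simp
  have "b0 \<noteq> t" using T.source_edge_to_R[OF j b0 s(1)] t by blast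
  then have "t \<in> Range ?R" using t(1) by blast
  then show ?thesis using S.Range_R_subset[OF h] by blast
qed

text \<open>If the edge of \<open>M j\<close> into \<open>b'\<close> started in a node, it would
  also lie in \<open>M j'\<close> and collide there with \<open>(s, b')\<close>. So it starts at
  \<open>s\<close>, the only other vertex available.\<close>

lemma source_edges_agree:
  assumes j: "j \<in> U" "j' \<in> U" and s: "(s, b) \<in> M j" "(s, b') \<in> M j'" "s \<notin> Domain R"
  shows "b = b'"
proof -
  have b': "b' \<in> Range R" using T.source_edge_to_R[OF j(2) s(2,3)] .
  obtain a where a: "(a, b') \<in> M j" using T.Range_R_subset[OF j(1)] b' by blast
  have "a \<notin> Domain R"
  proof
    assume aR: "a \<in> Domain R"
    then have "(a, b') \<in> M j'" using inner_edges_agree[OF j a _ b'] by blast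
    then have "a = s" using s(2) j(2) bimatching_sndD[OF bimatching_family] by blast
    then show False using aR s(3) by blast
  qed
  moreover obtain s' where "Domain (M j) = insert s' (Domain R)"
    using T.unique_source[OF j(1) card_M_R[OF j(1)]] by blast
  ultimately have "a = s" using a s by (metis DomainI insertE)
  then show ?thesis using a s(1) j(1) bimatching_fstD[OF bimatching_family] by blast
qed

lemma disjoint_extremal_family_converse:
  "disjoint_extremal_family I (\<lambda>i. (M i)\<inverse>) k (R\<inverse>) (\<lambda>e. \<phi> (prod.swap e))"
proof -
  interpret conv: extremal_family I "\<lambda>i. (M i)\<inverse>" k by (rule extremal_family_converse)
  have im: "(\<lambda>e. \<phi> (prod.swap e)) ` R\<inverse> = \<phi> ` R" by force
  show ?thesis
  proof
    show "conv.near_rainbow (R\<inverse>) (\<lambda>e. \<phi> (prod.swap e))"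
      using R rainbow_converse[of I M R \<phi>] by (simp add: near_rainbow_def conv.near_rainbow_def)
    show "(M j)\<inverse> \<inter> R\<inverse> = {}" if "j \<in> I - (\<lambda>e. \<phi> (prod.swap e)) ` R\<inverse>" for j
      using that disjoint[of j] im by auto
  qed
qed

end

context disjoint_extremal_family
begin

interpretation T: tight_no_augmentation R U M
  by (rule near_rainbow_tight[OF R])

interpretation conv: disjoint_extremal_family I "\<lambda>i. (M i)\<inverse>" k "R\<inverse>" "\<lambda>e. \<phi> (prod.swap e)"
  by (rule disjoint_extremal_family_converse)

lemma image_swap: "(\<lambda>e. \<phi> (prod.swap e)) ` R\<inverse> = \<phi> ` R"
  by force

lemma backward_closed:
  assumes "j \<in> U" "h \<in> \<phi> ` R" "(a, b) \<in> R" "(a, b) \<in> M h" "(a', b) \<in> M j" "(a', b') \<in> R"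
  shows "(a', b') \<in> M h"
  using conv.forward_closed[of j h b a a' b'] assms unfolding image_swap by simp

lemma source_covered:
  assumes "j \<in> U" "h \<in> \<phi> ` R" "s \<in> Domain (M j)" "s \<notin> Domain R"
  shows "s \<in> Domain (M h)"
  using conv.sink_covered[of j h s] assms unfolding image_swap by simp

lemma sink_edges_agree:
  assumes "j \<in> U" "j' \<in> U" "(a, t) \<in> M j" "(a', t) \<in> M j'" "t \<notin> Range R"
  shows "a = a'"
  using conv.source_edges_agree[of j j' t a a'] assms unfolding image_swap by simp

text \<open>Membership in \<open>M h\<close> spreads both ways along the path \<open>M j\<close>,
  and some edge of \<open>R\<close> has colour \<open>h\<close>. If the first node of the path is in
  \<open>M h\<close>, the nodes outside \<open>M h\<close> are closed under predecessors; otherwise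
  those inside are.\<close>

lemma R_subset:
  assumes j: "j \<in> U" and h: "h \<in> \<phi> ` R"
  shows "R \<subseteq> M h"
proof -
  have bR: "bimatching R" using R near_rainbow_def by blast
  obtain s where s: "s \<notin> Domain R" "Domain (M j) = insert s (Domain R)"
    using T.unique_source[OF j card_M_R[OF j]] by blast
  then obtain b0 where b0: "(s, b0) \<in> M j" by blast
  have b0_only: "b = b0" if "(s, b) \<in> M j" for b
    using that b0 j bimatching_fstD[OF bimatching_family] by blast
  obtain e where e: "e \<in> R \<inter> M h"
    using h R unfolding near_rainbow_def rainbow_def by blast
  show ?thesis
  proof (cases "b0 \<in> Range (R \<inter> M h)")
    case True
    have "R - M h = {}"
    proof (rule T.no_closed_subset[OF j])
      show "M j \<inter> (R - M h) = {}" using disjoint[OF j] by blast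
      fix a b' assume ab: "(a, b') \<in> M j" "b' \<in> Range (R - M h)"
      obtain a' where a': "(a', b') \<in> R" "(a', b') \<notin> M h" using ab(2) by blast
      have "a \<noteq> s"
      proof
        assume "a = s"
        then have "b' = b0" using b0_only ab(1) by blast
        then show False using True a' bimatching_sndD[OF bR] by blast
      qed
      then obtain b where b: "(a, b) \<in> R" using ab(1) s by blast
      then have "(a, b) \<notin> M h" using forward_closed[OF j h b _ ab(1) a'(1)] a'(2) by blast
      then show "a \<in> Domain (R - M h)" using b by blast
    qed blast
    then show ?thesis by blast
  next
    case False
    have "R \<inter> M h = {}"
    proof (rule T.no_closed_subset[OF j])
      show "M j \<inter> (R \<inter> M h) = {}" using disjoint[OF j] by blast
      fix a b assume ab: "(a, b) \<in> M j" "b \<in> Range (R \<inter> M h)"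
      obtain a1 where a1: "(a1, b) \<in> R" "(a1, b) \<in> M h" using ab(2) by blast
      have "a \<noteq> s" using b0_only ab False by blast
      then obtain b' where b': "(a, b') \<in> R" using ab(1) s by blast
      then have "(a, b') \<in> M h" using backward_closed[OF j h a1 ab(1) b'] by blast
      then show "a \<in> Domain (R \<inter> M h)" using b' by blast
    qed blast
    then show ?thesis using e by blast
  qed
qed

text \<open>Only one edge of \<open>M h\<close> lies outside \<open>R\<close>, and it has to cover
  both \<open>s\<close> and \<open>t\<close>.\<close>

lemma used_matching:
  assumes j: "j \<in> U" and h: "h \<in> \<phi> ` R"
    and s: "s \<in> Domain (M j)" "s \<notin> Domain R" and t: "t \<in> Range (M j)" "t \<notin> Range R"
  shows "M h = insert (s, t) R"
proof -
  have hI: "h \<in> I" using h near_rainbow_image(1)[OF R] by blast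
  have sub: "R \<subseteq> M h" using R_subset[OF j h] .
  have "finite R" "card R = k" using R near_rainbow_def by auto
  then have "card (M h - R) = Suc 0"
    using sub card_family[OF hI] by (simp add: card_Diff_subset)
  then obtain e where e: "M h - R = {e}" by (auto simp: card_Suc_eq)
  obtain y where y: "(s, y) \<in> M h" using source_covered[OF j h s] by blast
  obtain x where x: "(x, t) \<in> M h" using sink_covered[OF j h t] by blast
  have "(s, y) = e" "(x, t) = e" using x y s t e by blast+
  then show ?thesis using e sub by blast
qed

text \<open>The matching \<open>M h\<close> determines \<open>s\<close> and \<open>t\<close>, so
  \<open>M j\<close> and \<open>M j'\<close> have the same source and sink; their inner, source and
  sink edges then agree.\<close>

lemma unused_subset:
  assumes j: "j \<in> U" "j' \<in> U" and h: "h \<in> \<phi> ` R"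
  shows "M j \<subseteq> M j'"
proof -
  obtain s t where s: "s \<notin> Domain R" "Domain (M j) = insert s (Domain R)"
    and t: "t \<notin> Range R" "Range (M j) = insert t (Range R)"
    using T.unique_source[OF j(1) card_M_R[OF j(1)]] T.unique_sink[OF j(1) card_M_R[OF j(1)]] by metis
  obtain s' t' where s': "s' \<notin> Domain R" "Domain (M j') = insert s' (Domain R)"
    and t': "t' \<notin> Range R" "Range (M j') = insert t' (Range R)"
    using T.unique_source[OF j(2) card_M_R[OF j(2)]] T.unique_sink[OF j(2) card_M_R[OF j(2)]] by metis
  have "M h = insert (s, t) R" "M h = insert (s', t') R"
    using used_matching[OF j(1) h] used_matching[OF j(2) h] s t s' t' by blast+
  then have "(s, t) = (s', t')" using s(1) by blast
  then have eq: "s' = s" "t' = t" by auto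
  show ?thesis
  proof (rule subrelI)
    fix a b assume ab: "(a, b) \<in> M j"
    show "(a, b) \<in> M j'"
    proof (cases "a \<in> Domain R")
      case True
      show ?thesis
      proof (cases "b \<in> Range R")
        case False
        then have "b = t" using ab t by blast
        moreover obtain a' where "(a', t) \<in> M j'" using t' eq by blast
        ultimately show ?thesis using sink_edges_agree[OF j ab] False by blast
      qed (use inner_edges_agree[OF j ab True] in blast)
    next
      case False
      then have "a = s" using ab s by blast
      moreover obtain b' where "(s, b') \<in> M j'" using s' eq by blast
      ultimately show ?thesis using source_edges_agree[OF j ab] False by blast
    qed
  qed
qed

end

text \<open>The last conclusion expresses connectedness: it prevents the union from splitting into
  several cycles.\<close>

theorem (in extremal_family) extremal_structure:
  assumes "k > 0"
  obtains H s t R P where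
    "H \<subseteq> I" "card H = k" "card (I - H) = k"
    "\<forall>h\<in>H. M h = insert (s, t) R" "\<forall>j\<in>I - H. M j = P"
    "finite R" "bimatching R" "card R = k" "bimatching P" "P \<inter> R = {}"
    "s \<notin> Domain R" "t \<notin> Range R"
    "Domain P = insert s (Domain R)" "Range P = insert t (Range R)"
    "\<forall>L\<subseteq>R. P\<inverse> `` Range L \<subseteq> Domain L \<longrightarrow> L = {}"
proof -
  obtain R \<phi> i where R: "near_rainbow R \<phi>" and i: "i \<in> I - \<phi> ` R" "M i \<inter> R = {}"
    using disjoint_near_rainbow_exists[OF assms] by blast
  interpret disjoint_extremal_family I M k R \<phi>
    by unfold_locales (use R disjoint_near_rainbow[OF R i] in auto)
  interpret T: tight_no_augmentation R "I - \<phi> ` R" M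
    by (rule near_rainbow_tight[OF R])
  obtain s where s: "s \<notin> Domain R" "Domain (M i) = insert s (Domain R)"
    using T.unique_source[OF i(1) card_M_R[OF i(1)]] by blast
  obtain t where t: "t \<notin> Range R" "Range (M i) = insert t (Range R)"
    using T.unique_sink[OF i(1) card_M_R[OF i(1)]] by blast
  have props: "finite R" "bimatching R" "card R = k" "bimatching (M i)"
    using R i(1) bimatching_family[of i] by (simp_all add: near_rainbow_def)
  then have "\<phi> ` R \<noteq> {}" using assms by auto
  then obtain h0 where h0: "h0 \<in> \<phi> ` R" by blast
  show ?thesis
  proof (rule that[of "\<phi> ` R" s t R "M i"])
    show "\<forall>h\<in>\<phi> ` R. M h = insert (s, t) R"
    proof
      fix h assume h: "h \<in> \<phi> ` R"
      show "M h = insert (s, t) R"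
        by (rule used_matching[OF i(1) h]) (simp_all add: s t)
    qed
    show "\<forall>j\<in>I - \<phi> ` R. M j = M i"
    proof
      fix j assume j: "j \<in> I - \<phi> ` R"
      show "M j = M i"
        using unused_subset[OF j i(1) h0] unused_subset[OF i(1) j h0] by (rule equalityI)
    qed
    show "\<forall>L\<subseteq>R. (M i)\<inverse> `` Range L \<subseteq> Domain L \<longrightarrow> L = {}"
    proof (intro allI impI)
      fix L assume L: "L \<subseteq> R" "(M i)\<inverse> `` Range L \<subseteq> Domain L"
      show "L = {}" by (rule T.no_closed_subset[OF i(1) L(1)]) (use L i in blast)+
    qed
  qed (fact near_rainbow_image[OF R] props i(2) s t)+
qed

subsection \<open>Cycles\<close>

text \<open>Consecutive edges meet, so the successors of the indices in \<open>J\<close> avoid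
  \<open>J\<close>. As \<open>J\<close> holds at least half of all indices, the successors form its
  complement and membership alternates.\<close>

lemma matching_in_even_cycle:
  assumes c: "cyclic_labelling (2 * n) C c" and N: "pairwise disjnt N" "N \<subseteq> C" "card N = n"
  shows "N = even_edges (2 * n) c \<or> N = odd_edges (2 * n) c"
proof -
  let ?K = "2 * n"
  obtain v where K: "?K \<ge> 3" and C: "C = c ` {1..?K}" and v: "inj_on v {..<?K}"
    and cv: "\<And>i. i \<in> {1..?K} \<Longrightarrow> c i = {v (i - 1), v (i mod ?K)}"
    using c unfolding cyclic_labelling_def by blast
  define \<sigma> where "\<sigma> i = (if i = ?K then 1 else Suc i)" for i
  define J where "J = {i \<in> {1..?K}. c i \<in> N}"
  have NJ: "N = c ` J" using N(2) C unfolding J_def by blast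
  have finJ: "finite J" unfolding J_def by simp
  have \<sigma>_range: "\<sigma> i \<in> {1..?K}" if "i \<in> {1..?K}" for i
    using that K unfolding \<sigma>_def by auto
  have \<sigma>_inj: "inj_on \<sigma> {1..?K}"
    unfolding \<sigma>_def inj_on_def by auto
  have next_notin: "\<sigma> i \<notin> J" if i: "i \<in> J" for i
  proof
    assume s: "\<sigma> i \<in> J"
    have iK: "i \<in> {1..?K}" using i J_def by blast
    have meet: "v (i mod ?K) \<in> c i" "v (i mod ?K) \<in> c (\<sigma> i)"
      using cv[OF iK] cv[OF \<sigma>_range[OF iK]] iK unfolding \<sigma>_def by auto
    \<comment> \<open>Disjointness is only given for distinct edges; consecutive edges differ
      because the cycle has at least three vertices.\<close>
    have "c i \<noteq> c (\<sigma> i)"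
    proof
      assume "c i = c (\<sigma> i)"
      then have "v (i - 1) \<in> {v (\<sigma> i - 1), v (\<sigma> i mod ?K)}"
        using cv[OF iK] cv[OF \<sigma>_range[OF iK]] by blast
      moreover have "i - 1 < ?K" "\<sigma> i - 1 < ?K" "\<sigma> i mod ?K < ?K"
        using iK \<sigma>_range[OF iK] by auto
      ultimately have "i - 1 = \<sigma> i - 1 \<or> i - 1 = \<sigma> i mod ?K"
        using v unfolding inj_on_def by auto
      then show False
        using K iK unfolding \<sigma>_def by (cases "Suc i = ?K") (auto split: if_splits)
    qed
    then have "disjnt (c i) (c (\<sigma> i))"
      using i s N(1) unfolding J_def pairwise_def by blast
    then show False using meet unfolding disjnt_def by blast
  qed
  have J_sub: "J \<subseteq> {1..?K}" unfolding J_def by blast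
  have image_J: "\<sigma> ` J = {1..?K} - J"
  proof (rule card_seteq)
    show "\<sigma> ` J \<subseteq> {1..?K} - J" using next_notin \<sigma>_range J_sub by blast
    \<comment> \<open>A lower bound suffices, so injectivity of \<open>c\<close> need not be
      established.\<close>
    have "n \<le> card J" using N(3) NJ card_image_le[OF finJ, of c] by simp
    moreover have "card ({1..?K} - J) = ?K - card J"
      using J_sub finJ by (simp add: card_Diff_subset)
    moreover have "card (\<sigma> ` J) = card J"
      using \<sigma>_inj J_sub by (meson card_image inj_on_subset)
    ultimately show "card ({1..?K} - J) \<le> card (\<sigma> ` J)" by simp
  qed simp
  have prev_in: "i \<in> J" if i: "\<sigma> i \<notin> J" "i \<in> {1..?K}" for i
  proof -
    have "\<sigma> i \<in> \<sigma> ` J" unfolding image_J using i(1) \<sigma>_range[OF i(2)] by (rule DiffI[rotated])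
    then obtain j where j: "j \<in> J" "\<sigma> j = \<sigma> i" by (metis imageE)
    then have "j = i" using inj_onD[OF \<sigma>_inj _ _ i(2)] J_sub by blast
    then show ?thesis using j(1) by simp
  qed
  have parity: "i \<in> J \<longleftrightarrow> (1 \<in> J \<longleftrightarrow> odd i)" if "i \<in> {1..?K}" for i
    using that
  proof (induction i)
    case (Suc i)
    show ?case
    proof (cases "i = 0")
      case False
      then have i: "i \<in> {1..?K}" "\<sigma> i = Suc i" using Suc.prems by (auto simp: \<sigma>_def)
      then have "Suc i \<in> J \<longleftrightarrow> i \<notin> J" using next_notin[of i] prev_in[of i] by auto
      then show ?thesis using Suc.IH i(1) by auto
    qed simp
  qed simp
  show ?thesis
  proof (cases "1 \<in> J")
    case True
    then have "J = {j \<in> {1..?K}. odd j}" using parity J_sub by blast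
    then show ?thesis using NJ unfolding odd_edges_def by simp
  next
    case False
    then have "J = {j \<in> {1..?K}. even j}" using parity J_sub by blast
    then show ?thesis using NJ unfolding even_edges_def by simp
  qed
qed

section \<open>The alternating cycle of two matchings\<close>

definition edge_of :: "'a \<times> 'a \<Rightarrow> 'a set" where
  "edge_of e = {fst e, snd e}"

lemma funpow_eq_start:
  assumes "inj_on f D" "\<And>x. (f ^^ x) s \<in> D" "(f ^^ (x + d)) s = (f ^^ x) s"
  shows "(f ^^ d) s = s"
  using assms(3)
proof (induction x)
  case (Suc x)
  then have "f ((f ^^ (x + d)) s) = f ((f ^^ x) s)" by simp
  then show ?case using Suc.IH assms(1,2) unfolding inj_on_def by blast
qed simp

text \<open>Going forward along \<open>P\<close> and back along \<open>R\<close> with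
  \<open>(s, t)\<close> permutes \<open>Domain P\<close>. The orbit of \<open>s\<close> alternates
  with its \<open>P\<close>-partners on a cycle, and by \<open>conn\<close> the orbit is all of
  \<open>Domain P\<close>.\<close>

lemma cyclic_labelling_alternating:
  assumes R: "finite R" "bimatching R" "card R = k" "k > 0" and P: "bimatching P"
    and st: "s \<notin> Domain R" "t \<notin> Range R"
    and DP: "Domain P = insert s (Domain R)" and RP: "Range P = insert t (Range R)"
    and disj: "Domain P \<inter> Range P = {}"
    and conn: "\<forall>L\<subseteq>R. P\<inverse> `` Range L \<subseteq> Domain L \<longrightarrow> L = {}"
  shows "cycle_edge_set (2 * Suc k) (edge_of ` (P \<union> insert (s, t) R))"
proof -
  let ?R = "insert (s, t) R" and ?D = "Domain P"
  have bR: "bimatching ?R" using R(2) st by (rule bimatching_insert)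
  have "\<forall>a\<in>?D. \<exists>b. (a, b) \<in> P" by blast
  then obtain p where p: "\<And>a. a \<in> ?D \<Longrightarrow> (a, p a) \<in> P" by metis
  have p_eq: "b = p a" if "(a, b) \<in> P" for a b
    using that p[of a] bimatching_fstD[OF P] by blast
  have "\<forall>b\<in>Range P. \<exists>a. (a, b) \<in> ?R" using RP by blast
  then obtain r where r: "\<And>b. b \<in> Range P \<Longrightarrow> (r b, b) \<in> ?R" by metis
  have r_eq: "a = r b" if "(a, b) \<in> ?R" for a b
    using that r[of b] RP bimatching_sndD[OF bR] by blast
  define \<pi> where "\<pi> a = r (p a)" for a
  define \<alpha> where "\<alpha> x = (\<pi> ^^ x) s" for x :: nat
  have pR: "p a \<in> Range P" if "a \<in> ?D" for a using p[OF that] by blast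
  have \<pi>D: "\<pi> a \<in> ?D" if "a \<in> ?D" for a
    using r[OF pR[OF that]] DP unfolding \<pi>_def by blast
  have p_inj: "inj_on p ?D"
    using p bimatching_sndD[OF P] by (metis inj_onI)
  have \<pi>_inj: "inj_on \<pi> ?D"
  proof (rule inj_onI)
    fix a a' assume a: "a \<in> ?D" "a' \<in> ?D" "\<pi> a = \<pi> a'"
    then have "(\<pi> a, p a) \<in> ?R" "(\<pi> a, p a') \<in> ?R"
      using r[OF pR] unfolding \<pi>_def by metis+
    then have "p a = p a'" using bimatching_fstD[OF bR] by blast
    then show "a = a'" using p_inj a unfolding inj_on_def by blast
  qed
  have \<alpha>D: "\<alpha> x \<in> ?D" for x
    unfolding \<alpha>_def by (induction x) (use \<pi>D DP in auto)
  have \<alpha>_Suc: "\<alpha> (Suc x) = \<pi> (\<alpha> x)" for x unfolding \<alpha>_def by simp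
  have \<alpha>_0: "\<alpha> 0 = s" unfolding \<alpha>_def by simp
  have \<alpha>_cancel: "\<alpha> d = s" if "\<alpha> (x + d) = \<alpha> x" for x d
    using funpow_eq_start[OF \<pi>_inj, of s x d] \<alpha>D that unfolding \<alpha>_def by blast
  have D_range: "?D \<subseteq> range \<alpha>"
  proof -
    \<comment> \<open>A node entered along \<open>P\<close> from the orbit is on the orbit. So
      predecessors of missed nodes are missed too, and none of them is \<open>s\<close>.\<close>
    let ?L = "{e \<in> R. fst e \<notin> range \<alpha>}"
    have "?L = {}"
    proof (rule conn[rule_format])
      show "P\<inverse> `` Range ?L \<subseteq> Domain ?L"
      proof
        fix a assume "a \<in> P\<inverse> `` Range ?L"
        then obtain b where ab: "(a, b) \<in> P" "b \<in> Range ?L" by blast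
        then obtain c where c: "(c, b) \<in> R" "c \<notin> range \<alpha>" by auto
        have "c = \<pi> a" using r_eq[of c b] c(1) p_eq[OF ab(1)] unfolding \<pi>_def by simp
        then have a: "a \<notin> range \<alpha>" using c(2) \<alpha>_Suc by (metis rangeE rangeI)
        then have "a \<noteq> s" using \<alpha>_0 by (metis rangeI)
        then have "a \<in> Domain R" using ab(1) DP by (metis DomainI insertE)
        then show "a \<in> Domain ?L" using a by auto
      qed
    qed blast
    then have "Domain R \<subseteq> range \<alpha>" by fastforce
    then show ?thesis using DP \<alpha>_0 by (metis insert_subset rangeI)
  qed
  have finD: "finite ?D" and cardD: "card ?D = Suc k"
    using DP st R by (simp_all add: finite_Domain card_Domain_bimatching)
  have "\<exists>m. m > 0 \<and> \<alpha> m = s"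
  proof -
    have "\<not> inj \<alpha>"
      using finD \<alpha>D by (metis finite_subset image_subsetI infinite_UNIV_nat finite_imageD)
    then obtain x y where "x < y" "\<alpha> x = \<alpha> y"
      unfolding inj_on_def by (metis linorder_neqE_nat)
    then have "\<alpha> (y - x) = s" using \<alpha>_cancel[of x "y - x"] by simp
    then show ?thesis using \<open>x < y\<close> by (intro exI[of _ "y - x"]) simp
  qed
  then obtain m where m: "m > 0" "\<alpha> m = s" and least: "\<And>x. x > 0 \<Longrightarrow> x < m \<Longrightarrow> \<alpha> x \<noteq> s"
    using exists_least_iff[of "\<lambda>m. m > 0 \<and> \<alpha> m = s"] by blast
  have \<alpha>_inj: "inj_on \<alpha> {..<m}"
  proof (rule linorder_inj_onI)
    fix x y assume xy: "x < y" "x \<in> {..<m}" "y \<in> {..<m}"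
    then have "\<alpha> (y - x) \<noteq> s" using least[of "y - x"] by simp
    then show "\<alpha> x \<noteq> \<alpha> y" using \<alpha>_cancel[of x "y - x"] xy by auto
  qed (use nat_le_linear in blast)
  have D_eq: "?D = \<alpha> ` {..<m}"
  proof
    show "?D \<subseteq> \<alpha> ` {..<m}"
    proof
      fix a assume "a \<in> ?D"
      then obtain x where "a = \<alpha> x" using D_range by blast
      moreover have "\<alpha> (x mod m) = \<alpha> x"
        using m(2) unfolding \<alpha>_def by (rule funpow_mod_eq)
      ultimately show "a \<in> \<alpha> ` {..<m}" using m(1) by (metis imageI lessThan_iff mod_less_divisor)
    qed
  qed (use \<alpha>D in blast)
  have mk: "m = Suc k" using cardD D_eq \<alpha>_inj by (simp add: card_image)
  let ?K = "2 * m"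
  define v where "v i = (if even i then \<alpha> (i div 2) else p (\<alpha> (i div 2)))" for i
  define c where "c i = {v (i - 1), v (i mod ?K)}" for i
  have v_inj: "inj_on v {..<?K}"
  proof (rule inj_onI)
    fix x y assume xy: "x \<in> {..<?K}" "y \<in> {..<?K}" "v x = v y"
    have lt: "x div 2 < m" "y div 2 < m" using xy by auto
    have ne: "\<alpha> i \<noteq> p (\<alpha> j)" for i j using disj \<alpha>D[of i] pR[OF \<alpha>D[of j]] by force
    have par: "even x = even y" using xy(3) ne[of "x div 2" "y div 2"] ne[of "y div 2" "x div 2"]
      unfolding v_def by (auto split: if_splits)
    then have "\<alpha> (x div 2) = \<alpha> (y div 2)"
      using xy(3) inj_onD[OF p_inj _ \<alpha>D \<alpha>D] unfolding v_def by (auto split: if_splits)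
    then have "x div 2 = y div 2" using \<alpha>_inj lt unfolding inj_on_def by blast
    then show "x = y" using par by (metis even_two_times_div_two odd_two_times_div_two_succ)
  qed
  have v_mod: "v (i mod ?K) = v i" if "i \<le> ?K" for i
    using that m \<alpha>_0 by (cases "i = ?K") (auto simp: v_def)
  have c_odd: "c (2 * x + 1) = edge_of (\<alpha> x, p (\<alpha> x))" if "x < m" for x
    using that v_mod[of "2 * x + 1"] unfolding c_def edge_of_def by (simp add: v_def)
  have c_even: "c (2 * x + 2) = edge_of (\<alpha> (Suc x), p (\<alpha> x))" if "x < m" for x
    using that v_mod[of "2 * x + 2"] unfolding c_def edge_of_def by (auto simp: v_def)
  have P_eq: "P = (\<lambda>x. (\<alpha> x, p (\<alpha> x))) ` {..<m}"
  proof
    show "P \<subseteq> (\<lambda>x. (\<alpha> x, p (\<alpha> x))) ` {..<m}"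
    proof (rule subrelI)
      fix a b assume ab: "(a, b) \<in> P"
      then obtain x where "x < m" "a = \<alpha> x" using D_eq by blast
      then show "(a, b) \<in> (\<lambda>x. (\<alpha> x, p (\<alpha> x))) ` {..<m}" using p_eq[OF ab] by simp
    qed
  qed (use p \<alpha>D in blast)
  have R_eq: "?R = (\<lambda>x. (\<alpha> (Suc x), p (\<alpha> x))) ` {..<m}"
  proof
    show "?R \<subseteq> (\<lambda>x. (\<alpha> (Suc x), p (\<alpha> x))) ` {..<m}"
    proof (rule subrelI)
      fix a b assume ab: "(a, b) \<in> ?R"
      then have "b \<in> Range P" using RP by blast
      then obtain x where x: "x < m" "b = p (\<alpha> x)" using P_eq by blast
      then have "a = \<alpha> (Suc x)" using r_eq[OF ab] by (simp add: \<alpha>_Suc \<pi>_def)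
      then show "(a, b) \<in> (\<lambda>x. (\<alpha> (Suc x), p (\<alpha> x))) ` {..<m}" using x by simp
    qed
    show "(\<lambda>x. (\<alpha> (Suc x), p (\<alpha> x))) ` {..<m} \<subseteq> ?R"
      using r[OF pR[OF \<alpha>D]] by (auto simp only: \<alpha>_Suc \<pi>_def image_subset_iff)
  qed
  have idx: "{1..?K} = (\<lambda>x. 2 * x + 1) ` {..<m} \<union> (\<lambda>x. 2 * x + 2) ` {..<m}"
  proof
    show "{1..?K} \<subseteq> (\<lambda>x. 2 * x + 1) ` {..<m} \<union> (\<lambda>x. 2 * x + 2) ` {..<m}"
    proof
      fix i assume i: "i \<in> {1..?K}"
      have "(i - 1) div 2 < m" using i by auto
      moreover have "i = 2 * ((i - 1) div 2) + 1 \<or> i = 2 * ((i - 1) div 2) + 2" using i by auto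
      ultimately show "i \<in> (\<lambda>x. 2 * x + 1) ` {..<m} \<union> (\<lambda>x. 2 * x + 2) ` {..<m}" by blast
    qed
  qed auto
  have "c ` {1..?K} = edge_of ` P \<union> edge_of ` ?R"
    unfolding idx P_eq R_eq image_Un image_image using c_odd c_even by simp
  then have "cyclic_labelling ?K (edge_of ` (P \<union> ?R)) c"
    unfolding cyclic_labelling_def image_Un
    using v_inj mk R(4) by (auto simp: c_def)
  then show ?thesis unfolding cycle_edge_set_def mk by blast
qed

subsection \<open>Orienting a bipartite graph\<close>

text \<open>The sides \<open>A\<close> and \<open>B\<close> orient every edge, turning edge sets into relations.\<close>

locale bipartition =
  fixes A B :: "'a set" and E :: "'a set set"
  assumes AB: "A \<inter> B = {}" and E: "\<forall>e\<in>E. \<exists>a\<in>A. \<exists>b\<in>B. e = {a, b}"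
begin

definition oriented :: "'a set set \<Rightarrow> ('a \<times> 'a) set" where
  "oriented N = {e \<in> A \<times> B. edge_of e \<in> N}"

lemma edge_of_eq: "e \<in> A \<times> B \<Longrightarrow> f \<in> A \<times> B \<Longrightarrow> \<not> disjnt (edge_of e) (edge_of f) \<longleftrightarrow> fst e = fst f \<or> snd e = snd f"
  using AB unfolding edge_of_def disjnt_def by auto

lemma inj_edge_of: "inj_on edge_of (A \<times> B)"
  using AB unfolding edge_of_def inj_on_def by (auto simp: doubleton_eq_iff)

lemma edge_of_oriented: "N \<subseteq> E \<Longrightarrow> edge_of ` oriented N = N"
  using E unfolding oriented_def edge_of_def image_def by fastforce

lemma card_oriented: "N \<subseteq> E \<Longrightarrow> card (oriented N) = card N"
  using card_image[OF inj_on_subset[OF inj_edge_of, of "oriented N"]] edge_of_oriented[of N]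
  by (auto simp: oriented_def)

lemma bimatching_oriented:
  assumes "matching E N"
  shows "bimatching (oriented N)"
proof -
  have "e = f" if "e \<in> oriented N" "f \<in> oriented N" "fst e = fst f \<or> snd e = snd f" for e f
  proof -
    have ef: "e \<in> A \<times> B" "f \<in> A \<times> B" "edge_of e \<in> N" "edge_of f \<in> N"
      using that oriented_def by auto
    then have "\<not> disjnt (edge_of e) (edge_of f)" using edge_of_eq that(3) by blast
    then have "edge_of e = edge_of f"
      using assms ef unfolding matching_def pairwise_def by blast
    then show ?thesis using ef inj_edge_of unfolding inj_on_def by blast
  qed
  then show ?thesis unfolding bimatching_def inj_on_def by blast
qed

lemma rainbow_matching_edge_of:
  assumes Q: "bimatching Q" and M: "\<forall>i\<in>I. M i \<subseteq> E"
    and \<phi>: "rainbow I (\<lambda>i. oriented (M i)) Q \<phi>"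
  shows "rainbow_matching E I M (edge_of ` Q)" "card (edge_of ` Q) = card Q"
proof -
  have mem: "e \<in> A \<times> B \<and> \<phi> e \<in> I \<and> edge_of e \<in> M (\<phi> e)" if "e \<in> Q" for e
    using \<phi> that unfolding rainbow_def oriented_def by blast
  have inj: "inj_on edge_of Q" by (rule inj_on_subset[OF inj_edge_of]) (use mem in blast)
  then show "card (edge_of ` Q) = card Q" by (rule card_image)
  have "pairwise disjnt (edge_of ` Q)"
  proof (rule pairwiseI)
    fix x y assume "x \<in> edge_of ` Q" "y \<in> edge_of ` Q" "x \<noteq> y"
    then obtain e f where ef: "e \<in> Q" "f \<in> Q" "x = edge_of e" "y = edge_of f" "e \<noteq> f" by blast
    then have "fst e \<noteq> fst f" "snd e \<noteq> snd f"
      using Q unfolding bimatching_def inj_on_def by blast+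
    then show "disjnt x y" using edge_of_eq[of e f] mem ef by blast
  qed
  moreover have "edge_of ` Q \<subseteq> E" using mem M by blast
  moreover have "inj_on (\<lambda>x. \<phi> (inv_into Q edge_of x)) (edge_of ` Q)"
    using \<phi> inj unfolding rainbow_def by (auto simp: inj_on_def)
  moreover have "\<phi> (inv_into Q edge_of x) \<in> I \<and> x \<in> M (\<phi> (inv_into Q edge_of x))"
    if "x \<in> edge_of ` Q" for x
    using that mem inj by auto
  ultimately show "rainbow_matching E I M (edge_of ` Q)"
    unfolding rainbow_matching_def matching_def by blast
qed

lemma extremal_family_oriented:
  assumes "finite I" "card I = 2 * k" and M: "\<forall>i\<in>I. matching E (M i) \<and> card (M i) = Suc k"
    and no: "\<not> (\<exists>R. rainbow_matching E I M R \<and> card R = Suc k)"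
  shows "extremal_family I (\<lambda>i. oriented (M i)) k"
proof
  have sub: "\<forall>i\<in>I. M i \<subseteq> E" using M unfolding matching_def by blast
  show "bimatching (oriented (M i))" if "i \<in> I" for i
    using bimatching_oriented M that by blast
  show "card (oriented (M i)) = Suc k" if "i \<in> I" for i
    using card_oriented[OF bspec[OF sub that]] bspec[OF M that] by simp
  fix Q \<phi> assume Q: "bimatching Q" "finite Q" "rainbow I (\<lambda>i. oriented (M i)) Q \<phi>"
  show "card Q \<le> k"
  proof (rule ccontr)
    assume "\<not> card Q \<le> k"
    \<comment> \<open>Only size exactly \<open>Suc k\<close> is excluded by assumption, so a larger
      rainbow matching is cut down to that size.\<close>
    then obtain Q' where Q': "Q' \<subseteq> Q" "card Q' = Suc k"
      using obtain_subset_with_card_n[of "Suc k" Q] by auto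
    have "bimatching Q'" by (rule bimatching_subset[OF Q(1) Q'(1)])
    moreover have "rainbow I (\<lambda>i. oriented (M i)) Q' \<phi>"
      by (rule rainbow_subset[OF Q(3) Q'(1) subset_refl])
    ultimately show False
      using rainbow_matching_edge_of[OF _ sub, of Q' \<phi>] no Q'(2) by metis
  qed
qed (use assms(1,2) in simp_all)

end

theorem theorem1p4:
  fixes n :: nat and V :: "'a set" and E :: "'a set set" and M :: "nat \<Rightarrow> 'a set set"
  assumes "n \<ge> 2"
    and "bipartite_graph V E"
    and "\<forall>i\<in>{1..2*n-2}. matching E (M i) \<and> card (M i) = n"
    and "\<not> (\<exists>R. rainbow_matching E {1..2*n-2} M R \<and> card R = n)"
  shows "cycle_edge_set (2*n) (\<Union>i\<in>{1..2*n-2}. M i) \<and>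
    (\<forall>c. cyclic_labelling (2*n) (\<Union>i\<in>{1..2*n-2}. M i) c \<longrightarrow>
       card {i \<in> {1..2*n-2}. M i = even_edges (2*n) c} = n - 1 \<and>
       card {i \<in> {1..2*n-2}. M i = odd_edges (2*n) c} = n - 1 \<and>
       {i \<in> {1..2*n-2}. M i = odd_edges (2*n) c}
         = {1..2*n-2} - {i \<in> {1..2*n-2}. M i = even_edges (2*n) c})"
proof -
  let ?I = "{1..2*n-2}"
  obtain k where k: "n = Suc k" "k > 0" using assms(1) by (cases n) auto
  obtain A B where "A \<inter> B = {}" "\<forall>e\<in>E. \<exists>a\<in>A. \<exists>b\<in>B. e = {a, b}"
    using assms(2) unfolding bipartite_graph_def by blast
  then interpret bipartition A B E by unfold_locales
  interpret extremal_family ?I "\<lambda>i. oriented (M i)" k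
    by (rule extremal_family_oriented) (use assms(3,4) k in auto)
  have edges: "edge_of ` oriented (M i) = M i" if "i \<in> ?I" for i
    using assms(3) that by (intro edge_of_oriented) (auto simp: matching_def)
  obtain H s t R P where H: "H \<subseteq> ?I" "card H = k" "card (?I - H) = k"
    and used: "\<forall>h\<in>H. oriented (M h) = insert (s, t) R"
    and unused: "\<forall>j\<in>?I - H. oriented (M j) = P"
    and R: "finite R" "bimatching R" "card R = k" and P: "bimatching P" and PR: "P \<inter> R = {}"
    and st: "s \<notin> Domain R" "t \<notin> Range R"
      "Domain P = insert s (Domain R)" "Range P = insert t (Range R)"
    and conn: "\<forall>L\<subseteq>R. P\<inverse> `` Range L \<subseteq> Domain L \<longrightarrow> L = {}"
    by (rule extremal_structure[OF k(2)])
  define X where "X = edge_of ` insert (s, t) R"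
  define Y where "Y = edge_of ` P"
  have MX: "M h = X" if "h \<in> H" for h
    unfolding X_def using edges[of h] bspec[OF used that] subsetD[OF H(1) that] by metis
  have MY: "M j = Y" if "j \<in> ?I - H" for j
    unfolding Y_def using edges[of j] bspec[OF unused that] DiffD1[OF that] by metis
  obtain h where h: "h \<in> H" using H(2) k(2) by fastforce
  obtain j where j: "j \<in> ?I - H" using H(3) k(2) by (metis card.empty ex_in_conv less_irrefl)
  \<comment> \<open>Distinctness makes the index sets of \<open>X\<close> and \<open>Y\<close>
    complementary; it holds because \<open>P\<close> avoids the nonempty \<open>R\<close>.\<close>
  have "X \<noteq> Y"
  proof
    assume "X = Y"
    then have "insert (s, t) R = P" using bspec[OF used h] bspec[OF unused j] MX[OF h] MY[OF j] by simp
    then have "R = {}" using PR by blast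
    then show False using R k by simp
  qed
  have union: "(\<Union>i\<in>?I. M i) = Y \<union> X"
  proof
    show "(\<Union>i\<in>?I. M i) \<subseteq> Y \<union> X" using MX MY by blast
    show "Y \<union> X \<subseteq> (\<Union>i\<in>?I. M i)" using MX[OF h] MY[OF j] h j H(1) by blast
  qed
  have "P \<subseteq> A \<times> B" using bspec[OF unused j] unfolding oriented_def by blast
  then have "Domain P \<inter> Range P = {}" using AB by blast
  then have "cycle_edge_set (2 * Suc k) (edge_of ` (P \<union> insert (s, t) R))"
    by (rule cyclic_labelling_alternating[OF R k(2) P st]) (rule conn)
  then have "cycle_edge_set (2 * n) (edge_of ` (P \<union> insert (s, t) R))"
    by (simp only: k(1))
  then have "cycle_edge_set (2 * n) (\<Union>i\<in>?I. M i)"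
    unfolding union X_def Y_def image_Un .
  moreover have "card {i \<in> ?I. M i = even_edges (2*n) c} = n - 1 \<and>
       card {i \<in> ?I. M i = odd_edges (2*n) c} = n - 1 \<and>
       {i \<in> ?I. M i = odd_edges (2*n) c} = ?I - {i \<in> ?I. M i = even_edges (2*n) c}"
    if c: "cyclic_labelling (2*n) (\<Union>i\<in>?I. M i) c" for c
  proof -
    \<comment> \<open>The labelling is arbitrary, so which of \<open>X\<close> and \<open>Y\<close>
      is the even class is left open until the case split.\<close>
    have "M i = even_edges (2*n) c \<or> M i = odd_edges (2*n) c" if "i \<in> ?I" for i
      by (rule matching_in_even_cycle[OF c]) (use assms(3) that in \<open>auto simp: matching_def\<close>)
    then have "X = even_edges (2*n) c \<or> X = odd_edges (2*n) c"
      "Y = even_edges (2*n) c \<or> Y = odd_edges (2*n) c"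
      using MX[OF h] MY[OF j] h j H(1) by blast+
    then have XY: "X = even_edges (2*n) c \<and> Y = odd_edges (2*n) c
        \<or> X = odd_edges (2*n) c \<and> Y = even_edges (2*n) c"
      using \<open>X \<noteq> Y\<close> by metis
    have sets: "{i \<in> ?I. M i = X} = H" "{i \<in> ?I. M i = Y} = ?I - H" "?I - (?I - H) = H"
      using MX MY \<open>X \<noteq> Y\<close> H(1) by blast+
    have nk: "n - 1 = k" using k(1) by simp
    from XY show ?thesis
    proof (elim disjE conjE)
      assume "X = even_edges (2*n) c" "Y = odd_edges (2*n) c"
      note eqs = this[symmetric]
      show ?thesis unfolding eqs sets nk using H(2,3) by simp
    next
      assume "X = odd_edges (2*n) c" "Y = even_edges (2*n) c"
      note eqs = this[symmetric]
      show ?thesis unfolding eqs sets nk using H(2,3) by simp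
    qed
  qed
  ultimately show ?thesis by blast
qed

end
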